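(* Let $\Gamma=(X,R)$ be a distance-regular graph with diameter $d\ge 3$ and eigenvalues $\theta_0>\theta_1>\cdots>\theta_d$, and let $a_1,b_1$ denote its intersection numbers. Set $$b^-:=-1-\frac{b_1}{1+\theta_1},\qquad b^+:=-1-\frac{b_1}{1+\theta_d}.$$ Then the following are equivalent. (i) $\Gamma$ is tight. (ii) For all $x\in X$, the local graph $\Delta(x)$ is connected strongly-regular with eigenvalues $a_1, b^+, b^-$. (iii) There exists $x\in X$ for which the local graph $\Delta(x)$ is connected strongly-regular with eigenvalues $a_1,b^+,b^-$.
   Context: Graphs are finite, undirected, without loops or multiple edges. For a connected graph $\Gamma=(X,R)$ with vertex set $X$, edge set $R$, path-length distance $\partial$ and diameter $d=\max\{\partial(x,y): x,y\in X\}$, put $\Gamma_i(x)=\{y\in X:\partial(x,y)=i\}$ and $\Gamma(x)=\Gamma_1(x)$. A connected graph $\Gamma$ is distance-regular if for all $0\le h,i,j\le d$ and all $x,y\in X$ with $\partial(x,y)=h$ the number $p^h_{ij}=|\Gamma_i(x)\cap\Gamma_j(y)|$ does not depend on $x,y$. Then $c_i=p^i_{1,i-1}$ $(1\le i\le d)$, $a_i=p^i_{1i}$ $(0\le i\le d)$, $b_i=p^i_{1,i+1}$ $(0\le i\le d-1)$, $c_0=0$, $b_d=0$, and $k=b_0$ is the valency. The eigenvalues of $\Gamma$ are the distinct eigenvalues of its adjacency matrix; there are exactly $d+1$ of them, all real, $\theta_0>\theta_1>\cdots>\theta_d$, with $\theta_0=k$. $\Gamma$ is bipartite iff $a_i=0$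 for $0\le i\le d$. It is known that $\theta_d<-1<\theta_1$ when $d\ge 3$, so $b^\pm$ are well defined. $\Gamma$ (with $d\ge3$) is tight if it is not bipartite and $\left(\theta_1+\frac{k}{a_1+1}\right)\left(\theta_d+\frac{k}{a_1+1}\right)=-\frac{ka_1b_1}{(a_1+1)^2}$. For $x\in X$ the local graph $\Delta(x)$ is the subgraph of $\Gamma$ induced on $\Gamma(x)$; it has $k$ vertices, is regular of valency $a_1$, and is not a clique. A graph $\Delta$ is strongly-regular with parameters $(\nu,\kappa,\lambda,\mu)$ if it has $\nu$ vertices, is regular of valency $\kappa$, adjacent vertices have exactly $\lambda$ common neighbours, and distinct nonadjacent vertices have exactly $\mu$ common neighbours. A connected strongly-regular graph that is not a clique has exactly three distinct (adjacency) eigenvalues, one of which is its valency; "with eigenvalues $a_1,b^+,b^-$" means that these are the distinct eigenvalues of its adjacency matrix. *)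

theory Defs
  imports
    "Graph_Theory.Graph_Theory"
    "Jordan_Normal_Form.Char_Poly"
begin

text \<open>
  A finite undirected graph without loops or multiple edges is a \<^term>\<open>G\<close> satisfying
  \<^const>\<open>graph\<close>, i.e. a finite symmetric digraph without loops or parallel arcs.
\<close>

text \<open>
  Path-length distance. A walk of minimal length is a path. The value is meaningful only
  when \<open>y\<close> can be reached from \<open>x\<close>; below it is used for connected graphs only.
\<close>

definition graph_dist :: "('a, 'b) pre_digraph \<Rightarrow> 'a \<Rightarrow> 'a \<Rightarrow> nat" where
  "graph_dist G x y = (LEAST n. \<exists>p. pre_digraph.awalk G x p y \<and> length p = n)"

definition diameter :: "('a, 'b) pre_digraph \<Rightarrow> nat" where
  "diameter G = Max {graph_dist G x y | x y. x \<in> verts G \<and> y \<in> verts G}"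

definition sphere :: "('a, 'b) pre_digraph \<Rightarrow> nat \<Rightarrow> 'a \<Rightarrow> 'a set" where
  "sphere G i x = {y \<in> verts G. graph_dist G x y = i}"

definition distance_regular :: "('a, 'b) pre_digraph \<Rightarrow> bool" where
  "distance_regular G \<longleftrightarrow> graph G \<and> Digraph_Component.connected G \<and>
    (\<forall>h \<le> diameter G. \<forall>i \<le> diameter G. \<forall>j \<le> diameter G. \<exists>p.
      \<forall>x \<in> verts G. \<forall>y \<in> verts G. graph_dist G x y = h \<longrightarrow>
        card (sphere G i x \<inter> sphere G j y) = p)"

text \<open>
  The number \<open>p\<^sup>h\<^sub>i\<^sub>j\<close> of a distance-regular graph, for \<open>h, i, j\<close> at most the diameter.
\<close>

definition intersection_number :: "('a, 'b) pre_digraph \<Rightarrow> nat \<Rightarrow> nat \<Rightarrow> nat \<Rightarrow> nat" where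
  "intersection_number G h i j =
    (THE p. \<forall>x \<in> verts G. \<forall>y \<in> verts G. graph_dist G x y = h \<longrightarrow>
      card (sphere G i x \<inter> sphere G j y) = p)"

definition int_a :: "('a, 'b) pre_digraph \<Rightarrow> nat \<Rightarrow> nat" where
  "int_a G i = intersection_number G i 1 i"

definition int_b :: "('a, 'b) pre_digraph \<Rightarrow> nat \<Rightarrow> nat" where
  "int_b G i = (if i < diameter G then intersection_number G i 1 (i + 1) else 0)"

definition valency :: "('a, 'b) pre_digraph \<Rightarrow> nat" where
  "valency G = int_b G 0"

text \<open>Used only for distance-regular graphs.\<close>

definition bipartite :: "('a, 'b) pre_digraph \<Rightarrow> bool" where
  "bipartite G \<longleftrightarrow> (\<forall>i \<le> diameter G. int_a G i = 0)"

text \<open>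
  The adjacency matrix with respect to an enumeration \<open>xs\<close> of the vertices. Another
  enumeration conjugates it by a permutation matrix, so the eigenvalues do not depend on \<open>xs\<close>.
  The matrix is real symmetric, so its real eigenvalues are all of its eigenvalues.
\<close>

definition adjacency_matrix :: "('a, 'b) pre_digraph \<Rightarrow> 'a list \<Rightarrow> real mat" where
  "adjacency_matrix G xs =
    mat (length xs) (length xs) (\<lambda>(i, j). if xs ! i \<rightarrow>\<^bsub>G\<^esub> xs ! j then 1 else 0)"

definition graph_eigenvalues :: "('a, 'b) pre_digraph \<Rightarrow> real set" where
  "graph_eigenvalues G =
    {t. \<exists>xs. distinct xs \<and> set xs = verts G \<and> eigenvalue (adjacency_matrix G xs) t}"

text \<open>
  \<open>\<theta>\<^sub>0 > \<theta>\<^sub>1 > \<dots> > \<theta>\<^sub>d\<close> are the distinct eigenvalues; a distance-regular graph of diameter \<open>d\<close>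
  has exactly \<open>d + 1\<close> of them. Values \<open>\<theta> i\<close> with \<open>i > d\<close> are irrelevant.
\<close>

definition ordered_eigenvalues :: "('a, 'b) pre_digraph \<Rightarrow> (nat \<Rightarrow> real) \<Rightarrow> bool" where
  "ordered_eigenvalues G \<theta> \<longleftrightarrow>
    (\<forall>i j. i < j \<and> j \<le> diameter G \<longrightarrow> \<theta> j < \<theta> i) \<and>
    \<theta> ` {0..diameter G} = graph_eigenvalues G"

text \<open>Used only for distance-regular graphs of diameter at least 3.\<close>

definition tight :: "('a, 'b) pre_digraph \<Rightarrow> bool" where
  "tight G \<longleftrightarrow> \<not> bipartite G \<and>
    (\<exists>\<theta>. ordered_eigenvalues G \<theta> \<and>
      (let k = real (valency G); a1 = real (int_a G 1); b1 = real (int_b G 1) in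
        (\<theta> 1 + k / (a1 + 1)) * (\<theta> (diameter G) + k / (a1 + 1))
          = - (k * a1 * b1) / (a1 + 1)\<^sup>2))"

definition local_graph :: "('a, 'b) pre_digraph \<Rightarrow> 'a \<Rightarrow> ('a, 'b) pre_digraph" where
  "local_graph G x = G \<restriction> sphere G 1 x"

definition neighbours :: "('a, 'b) pre_digraph \<Rightarrow> 'a \<Rightarrow> 'a set" where
  "neighbours G x = {y \<in> verts G. x \<rightarrow>\<^bsub>G\<^esub> y}"

definition strongly_regular ::
  "('a, 'b) pre_digraph \<Rightarrow> nat \<Rightarrow> nat \<Rightarrow> nat \<Rightarrow> nat \<Rightarrow> bool" where
  "strongly_regular G \<nu> \<kappa> l m \<longleftrightarrow> graph G \<and>
    card (verts G) = \<nu> \<and>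
    (\<forall>x \<in> verts G. card (neighbours G x) = \<kappa>) \<and>
    (\<forall>x \<in> verts G. \<forall>y \<in> verts G. x \<rightarrow>\<^bsub>G\<^esub> y \<longrightarrow>
      card (neighbours G x \<inter> neighbours G y) = l) \<and>
    (\<forall>x \<in> verts G. \<forall>y \<in> verts G. x \<noteq> y \<and> \<not> x \<rightarrow>\<^bsub>G\<^esub> y \<longrightarrow>
      card (neighbours G x \<inter> neighbours G y) = m)"

definition connected_srg_with_eigenvalues ::
  "('a, 'b) pre_digraph \<Rightarrow> real \<Rightarrow> real \<Rightarrow> real \<Rightarrow> bool" where
  "connected_srg_with_eigenvalues G r s t \<longleftrightarrow>
    Digraph_Component.connected G \<and>
    (\<exists>\<nu> \<kappa> l m. strongly_regular G \<nu> \<kappa> l m) \<and>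
    distinct [r, s, t] \<and> graph_eigenvalues G = {r, s, t}"

end

theory Submission
  imports Defs
begin

text \<open>
  Write \<open>a = a\<^sub>1\<close>, \<open>b = b\<^sub>1\<close>, \<open>r = b\<^sup>-\<close> and \<open>s = b\<^sup>+\<close>. On the functions with
  sum zero, the adjacency operator of a local graph lies between \<open>r\<close> and \<open>s\<close>; tightness says that it
  attains no value strictly in between as an eigenvalue.

  Every eigenvalue \<open>\<theta>\<close> of a distance-regular graph has a cosine sequence \<open>\<omega>\<close>, and the matrix with
  entries \<open>\<omega> (\<partial> y z)\<close> is a positive multiple of an orthogonal projection, hence positive
  semidefinite (\<open>cosine_form_nonneg\<close>). Restricted to functions that live on the neighbourhood of one
  vertex and have sum zero, only the cosines of index 0, 1 and 2 occur. Positivity then becomes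
  \<open>(b + 1 + \<theta>) \<parallel>f\<parallel>\<^sup>2 + (1 + \<theta>) \<langle>f, A f\<rangle> \<ge> 0\<close>, where \<open>A\<close> is the adjacency operator of the local graph
  (\<open>local_form_bound\<close>). Since \<open>\<theta>\<^sub>d < -1 < \<theta>\<^sub>1\<close>, the choices \<open>\<theta>\<^sub>1\<close> and \<open>\<theta>\<^sub>d\<close> give
  \<open>r \<parallel>f\<parallel>\<^sup>2 \<le> \<langle>f, A f\<rangle> \<le> s \<parallel>f\<parallel>\<^sup>2\<close> for every \<open>f\<close> with sum zero.

  Consequently \<open>(s - A) (A - r)\<close> is positive semidefinite on these functions. Evaluated at differences
  of two point masses, this bounds the number of common neighbours of two vertices of the local graph
  from below (\<open>common_lower_bound\<close>). The sum of these numbers over a row is known, and the bound has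
  the same row sum exactly when \<open>k (a + r s) = (a - r) (a - s)\<close>, which is a rewriting of the equation
  that defines tightness (\<open>tight_equation_iff\<close>). So in a tight graph all the bounds are equalities:
  \<open>A\<^sup>2 = (r + s) A - r s I + (a + r s) J\<close>, and the local graph is strongly-regular with eigenvalues
  \<open>a, s, r\<close> (\<open>common_eq_of_tight\<close>, \<open>connected_srg_of_common\<close>).

  Conversely, a strongly-regular graph satisfies an equation \<open>A\<^sup>2 = \<alpha> A + \<beta> I + \<gamma> J\<close>. The eigenvalues
  \<open>r\<close> and \<open>s\<close> are the two roots of the corresponding quadratic, so one local graph with these
  eigenvalues determines the coefficients, and applying both sides to the constant function gives the
  tightness equation back (\<open>connected_srg_imp_tight_equation\<close>).

  Bipartite graphs are the ones with \<open>a = 0\<close> that satisfy the equation: there it forces \<open>\<theta>\<^sub>d = -k\<close>, and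
  an eigenvalue \<open>-k\<close> makes the graph bipartite (\<open>bipartite_of_minus_valency\<close>). A local graph with
  three distinct eigenvalues, on the other hand, has edges.

  The inequalities \<open>\<theta>\<^sub>d < -1 < \<theta>\<^sub>1\<close> come from the completeness of the \<open>d + 1\<close> cosine sequences: these are
  pairwise orthogonal vectors in a space of dimension \<open>d + 1\<close>, so identity and adjacency matrix are
  combinations of the cosine matrices (\<open>sum_cosines_eq_delta\<close>, \<open>sum_eigenvalue_cosines\<close>). Test
  vectors supported on two or three vertices then rule out that all eigenvalues other than \<open>k\<close> are
  at most \<open>-1\<close>, and that all eigenvalues are at least \<open>-1\<close>.
\<close>

section \<open>Adjacency operators and eigenvalues of graphs\<close>

text \<open>
  Functions on the vertices take the place of vectors and finite sums the place of matrix products,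
  so that no enumeration of the vertices is involved; \<open>graph_eigenvalues_iff\<close> links the two views.
\<close>
definition adj_op :: "'a set \<Rightarrow> ('a \<Rightarrow> 'a \<Rightarrow> bool) \<Rightarrow> ('a \<Rightarrow> real) \<Rightarrow> 'a \<Rightarrow> real" where
  "adj_op S E f x = (\<Sum>y | y \<in> S \<and> E x y. f y)"

lemma adj_op_eq_sum: "finite S \<Longrightarrow> adj_op S E f x = (\<Sum>y\<in>S. of_bool (E x y) * f y)"
  unfolding adj_op_def by (rule sum.mono_neutral_cong_left) auto

lemma adj_op_self_adjoint:
  assumes "finite S" and "\<And>x y. x \<in> S \<Longrightarrow> y \<in> S \<Longrightarrow> E x y = E y x"
  shows "(\<Sum>x\<in>S. f x * adj_op S E g x) = (\<Sum>x\<in>S. g x * adj_op S E f x)"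
proof -
  have "(\<Sum>x\<in>S. f x * adj_op S E g x) = (\<Sum>x\<in>S. \<Sum>y\<in>S. f x * (of_bool (E x y) * g y))"
    by (simp add: adj_op_eq_sum[OF assms(1)] sum_distrib_left)
  also have "\<dots> = (\<Sum>y\<in>S. \<Sum>x\<in>S. f x * (of_bool (E x y) * g y))"
    by (rule sum.swap)
  also have "\<dots> = (\<Sum>y\<in>S. \<Sum>x\<in>S. g y * (of_bool (E y x) * f x))"
    by (intro sum.cong refl) (auto simp: assms(2))
  finally show ?thesis
    by (simp add: adj_op_eq_sum[OF assms(1)] sum_distrib_left)
qed

lemma sum_of_bool_times:
  fixes f :: "'a \<Rightarrow> real"
  assumes "finite S" and "t \<in> S"
  shows "(\<Sum>x\<in>S. of_bool (x = t) * f x) = f t"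
proof -
  have "(\<Sum>x\<in>S. of_bool (x = t) * f x) = (\<Sum>x\<in>S. if x = t then f x else 0)"
    by (rule sum.cong) auto
  then show ?thesis using assms by simp
qed

lemma adjacency_matrix_mult_vec:
  assumes "distinct xs" "set xs = verts G" "i < length xs"
  shows "(adjacency_matrix G xs *\<^sub>v vec (length xs) (\<lambda>j. f (xs ! j))) $ i
    = adj_op (verts G) (dominates G) f (xs ! i)"
proof -
  have fin: "finite (verts G)" using assms(2) by (metis List.finite_set)
  have "(adjacency_matrix G xs *\<^sub>v vec (length xs) (\<lambda>j. f (xs ! j))) $ i
      = (\<Sum>j<length xs. of_bool (xs ! i \<rightarrow>\<^bsub>G\<^esub> xs ! j) * f (xs ! j))"
    unfolding of_bool_def
    using assms(3) by (simp add: adjacency_matrix_def scalar_prod_def atLeast0LessThan)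
  also have "\<dots> = (\<Sum>y\<in>verts G. of_bool (xs ! i \<rightarrow>\<^bsub>G\<^esub> y) * f y)"
    using sum.reindex_bij_betw[OF bij_betw_nth[OF assms(1) refl assms(2)[symmetric]],
      of "\<lambda>y. of_bool (xs ! i \<rightarrow>\<^bsub>G\<^esub> y) * f y"] .
  finally show ?thesis by (simp add: adj_op_eq_sum[OF fin])
qed

lemma graph_eigenvalues_iff:
  assumes fin: "finite (verts G)"
  shows "t \<in> graph_eigenvalues G \<longleftrightarrow>
    (\<exists>f. (\<exists>x\<in>verts G. f x \<noteq> 0) \<and> (\<forall>x\<in>verts G. adj_op (verts G) (dominates G) f x = t * f x))"
proof
  assume "t \<in> graph_eigenvalues G"
  then obtain xs v where xs: "distinct xs" "set xs = verts G"
    and v: "v \<in> carrier_vec (length xs)" "v \<noteq> 0\<^sub>v (length xs)"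
      "adjacency_matrix G xs *\<^sub>v v = t \<cdot>\<^sub>v v"
    by (auto simp: graph_eigenvalues_def eigenvalue_def eigenvector_def adjacency_matrix_def)
  \<comment> \<open>The eigenvector read as a function of the vertex instead of its position in \<open>xs\<close>.\<close>
  define f where "f x = v $ (THE i. i < length xs \<and> xs ! i = x)" for x
  have f: "f (xs ! i) = v $ i" if "i < length xs" for i
  proof -
    have "(THE j. j < length xs \<and> xs ! j = xs ! i) = i"
      using that xs(1) by (intro the_equality) (auto simp: nth_eq_iff_index_eq)
    then show ?thesis by (simp add: f_def)
  qed
  have v_eq: "v = vec (length xs) (\<lambda>j. f (xs ! j))" using v(1) f by auto
  obtain i where "i < length xs" "v $ i \<noteq> 0" using v(1,2) by (metis carrier_vecD eq_vecI index_zero_vec)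
  then have "f (xs ! i) \<noteq> 0" "xs ! i \<in> verts G" using f xs(2) nth_mem by auto
  moreover have "adj_op (verts G) (dominates G) f x = t * f x" if "x \<in> verts G" for x
  proof -
    obtain i where i: "i < length xs" "x = xs ! i" using \<open>x \<in> verts G\<close> xs(2) by (metis in_set_conv_nth)
    have "adj_op (verts G) (dominates G) f (xs ! i) = (adjacency_matrix G xs *\<^sub>v v) $ i"
      using adjacency_matrix_mult_vec[OF xs i(1), of f] v_eq by simp
    also have "\<dots> = t * f (xs ! i)" using v(1,3) f i(1) by simp
    finally show ?thesis using i(2) by simp
  qed
  ultimately show "\<exists>f. (\<exists>x\<in>verts G. f x \<noteq> 0) \<and>
    (\<forall>x\<in>verts G. adj_op (verts G) (dominates G) f x = t * f x)" by blast
next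
  assume "\<exists>f. (\<exists>x\<in>verts G. f x \<noteq> 0) \<and>
    (\<forall>x\<in>verts G. adj_op (verts G) (dominates G) f x = t * f x)"
  then obtain f x where x: "x \<in> verts G" "f x \<noteq> 0"
    and f: "\<And>x. x \<in> verts G \<Longrightarrow> adj_op (verts G) (dominates G) f x = t * f x" by blast
  obtain xs where xs: "set xs = verts G" "distinct xs" using finite_distinct_list[OF fin] by blast
  define v where "v = vec (length xs) (\<lambda>j. f (xs ! j))"
  obtain i where "i < length xs" "x = xs ! i" using x(1) xs(1) by (metis in_set_conv_nth)
  then have "v $ i \<noteq> 0\<^sub>v (length xs) $ i" using x(2) by (simp add: v_def)
  then have "v \<noteq> 0\<^sub>v (length xs)" by auto
  moreover have "adjacency_matrix G xs *\<^sub>v v = t \<cdot>\<^sub>v v"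
  proof (rule eq_vecI)
    fix i assume "i < dim_vec (t \<cdot>\<^sub>v v)"
    then have i: "i < length xs" by (simp add: v_def)
    then have "xs ! i \<in> verts G" using xs(1) nth_mem by blast
    then show "(adjacency_matrix G xs *\<^sub>v v) $ i = (t \<cdot>\<^sub>v v) $ i"
      using adjacency_matrix_mult_vec[OF xs(2,1) i, of f] f i by (simp add: v_def)
  qed (simp add: v_def adjacency_matrix_def)
  ultimately have "eigenvalue (adjacency_matrix G xs) t"
    unfolding eigenvalue_def eigenvector_def by (intro exI[of _ v]) (simp add: v_def adjacency_matrix_def)
  then show "t \<in> graph_eigenvalues G" using xs by (auto simp: graph_eigenvalues_def)
qed

section \<open>Common neighbours in regular graphs\<close>

text \<open>
  The valency is a real number because it enters only linear algebra. The locale is used for local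
  graphs, once in terms of the distance and once in terms of the arcs of the induced subgraph.
\<close>
locale regular_graph_on =
  fixes S :: "'a set" and E :: "'a \<Rightarrow> 'a \<Rightarrow> bool" and a :: real
  assumes finite_S: "finite S"
    and sym: "\<And>x y. x \<in> S \<Longrightarrow> y \<in> S \<Longrightarrow> E x y \<Longrightarrow> E y x"
    and irrefl: "\<And>x. x \<in> S \<Longrightarrow> \<not> E x x"
    and regular: "\<And>x. x \<in> S \<Longrightarrow> real (card {y \<in> S. E x y}) = a"
begin

abbreviation A :: "('a \<Rightarrow> real) \<Rightarrow> 'a \<Rightarrow> real" where "A \<equiv> adj_op S E"

definition common :: "'a \<Rightarrow> 'a \<Rightarrow> real" where
  "common y z = real (card {w \<in> S. E y w \<and> E z w})"

lemma sym_iff: "x \<in> S \<Longrightarrow> y \<in> S \<Longrightarrow> E x y = E y x"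
  using sym by blast

lemma self_adjoint: "(\<Sum>x\<in>S. f x * A g x) = (\<Sum>x\<in>S. g x * A f x)"
  by (rule adj_op_self_adjoint[OF finite_S sym_iff])

lemma A_diff: "A (\<lambda>x. f x - g x) y = A f y - A g y"
  and A_scale: "A (\<lambda>x. t * f x) y = t * A f y"
  by (simp_all add: adj_op_def sum_subtractf sum_distrib_left)

lemma A_const: "y \<in> S \<Longrightarrow> A (\<lambda>_. t) y = a * t"
  by (simp add: adj_op_def regular)

lemma sum_A: "(\<Sum>y\<in>S. A f y) = a * (\<Sum>y\<in>S. f y)"
  using self_adjoint[of "\<lambda>_. 1" f] by (simp add: A_const sum_distrib_left mult.commute)

lemma A_delta: "z \<in> S \<Longrightarrow> A (\<lambda>x. of_bool (x = z)) y = of_bool (E y z)"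
  using sum_of_bool_times[OF finite_S, of z "\<lambda>x. of_bool (E y x)"]
  by (simp add: adj_op_eq_sum[OF finite_S] mult.commute)

lemma common_eq_sum: "common y z = (\<Sum>w\<in>S. of_bool (E y w) * of_bool (E z w))"
proof -
  have "common y z = (\<Sum>w\<in>S. (of_bool (E y w \<and> E z w) :: real))"
    using finite_S by (simp add: common_def Int_def)
  then show ?thesis by (simp only: of_bool_conj)
qed

lemma common_self: "y \<in> S \<Longrightarrow> common y y = a"
  by (simp add: common_def regular)

lemma A_A_delta:
  assumes "y \<in> S" "z \<in> S"
  shows "A (A (\<lambda>x. of_bool (x = z))) y = common y z"
  unfolding common_eq_sum adj_op_eq_sum[OF finite_S, of _ "A _"]
  using assms by (intro sum.cong refl) (auto simp: A_delta sym_iff)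

text \<open>
  Double counting of the walks of length two that start at a vertex.
\<close>
lemma sum_common:
  assumes "y \<in> S" shows "(\<Sum>z\<in>S. common y z) = a * a"
proof -
  have "(\<Sum>z\<in>S. common y z) = (\<Sum>z\<in>S. A (A (\<lambda>x. of_bool (x = y))) z)"
    using assms by (intro sum.cong refl)
      (simp add: A_A_delta, simp add: common_def conj_commute)
  also have "\<dots> = a * (a * (\<Sum>z\<in>S. of_bool (z = y)))"
    by (simp only: sum_A)
  also have "(\<Sum>z\<in>S. of_bool (z = y)) = (1::real)"
    using finite_S assms by (simp add: of_bool_def)
  finally show ?thesis by simp
qed

text \<open>
  The hypotheses say that \<open>A - r\<close> and \<open>s - A\<close> are positive semidefinite on the functions with sum
  zero. These two operators commute and add up to the scalar \<open>s - r\<close>, so for \<open>g = (A - r) u\<close> and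
  \<open>h = (s - A) u\<close> the expression \<open>\<langle>g, (s - A) g\<rangle> + \<langle>h, (A - r) h\<rangle>\<close> equals
  \<open>(s - r) \<langle>u, (s - A) (A - r) u\<rangle>\<close>. Hence the product is positive semidefinite there as well, without
  any diagonalisation, and the claim is its value at the difference \<open>u\<close> of two point masses.
\<close>
lemma common_lower_bound:
  assumes lower: "\<And>f. (\<Sum>y\<in>S. f y) = 0 \<Longrightarrow> r * (\<Sum>y\<in>S. f y * f y) \<le> (\<Sum>y\<in>S. f y * A f y)"
    and upper: "\<And>f. (\<Sum>y\<in>S. f y) = 0 \<Longrightarrow> (\<Sum>y\<in>S. f y * A f y) \<le> s * (\<Sum>y\<in>S. f y * f y)"
    and "r < s" and y: "y \<in> S" and z: "z \<in> S" and "y \<noteq> z"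
  shows "(r + s) * of_bool (E y z) + (a + r * s) \<le> common y z"
proof -
  define u :: "'a \<Rightarrow> real" where "u x = of_bool (x = y) - of_bool (x = z)" for x
  define v where "v = A u"
  define w where "w = A v"
  define g where "g x = v x - r * u x" for x
  define h where "h x = s * u x - v x" for x
  \<comment> \<open>\<open>q = (s - A) (A - r) u\<close>, which is both \<open>(s - A) g\<close> and \<open>(A - r) h\<close>.\<close>
  define q where "q x = (s + r) * v x - r * s * u x - w x" for x
  have sum_u: "(\<Sum>x\<in>S. u x * f x) = f y - f z" for f
    using sum_of_bool_times[OF finite_S y, of f] sum_of_bool_times[OF finite_S z, of f]
    by (simp add: u_def left_diff_distrib sum_subtractf)
  have u0: "(\<Sum>x\<in>S. u x) = 0" using sum_u[of "\<lambda>_. 1"] by simp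
  have v0: "(\<Sum>x\<in>S. v x) = 0" using u0 by (simp add: v_def sum_A)
  have g0: "(\<Sum>x\<in>S. g x) = 0" and h0: "(\<Sum>x\<in>S. h x) = 0"
    using u0 v0 by (simp_all add: g_def h_def sum_subtractf flip: sum_distrib_left)
  have Ag: "A g x = w x - r * v x" for x
    unfolding g_def[abs_def] A_diff A_scale by (simp add: w_def v_def)
  have Ah: "A h x = s * v x - w x" for x
    unfolding h_def[abs_def] A_diff A_scale by (simp add: w_def v_def)
  have "0 \<le> (s * (\<Sum>x\<in>S. g x * g x) - (\<Sum>x\<in>S. g x * A g x))
      + ((\<Sum>x\<in>S. h x * A h x) - r * (\<Sum>x\<in>S. h x * h x))"
    using lower[OF h0] upper[OF g0] by simp
  also have "\<dots> = (\<Sum>x\<in>S. (s - r) * (u x * q x))"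
    unfolding sum_distrib_left sum_subtractf[symmetric] sum.distrib[symmetric]
    by (intro sum.cong refl) (simp add: Ag Ah, simp add: g_def h_def q_def algebra_simps)
  finally have "0 \<le> (s - r) * (\<Sum>x\<in>S. u x * q x)" by (simp add: sum_distrib_left)
  then have "0 \<le> q y - q z" using \<open>r < s\<close> by (simp add: zero_le_mult_iff sum_u)
  moreover have vx: "v x = of_bool (E x y) - of_bool (E x z)" for x
    unfolding v_def u_def[abs_def] by (simp add: A_diff A_delta y z)
  moreover have "w y = a - common y z" "w z = common y z - a"
    unfolding w_def v_def u_def[abs_def] A_diff
    using y z common_self A_A_delta
    by (simp_all add: A_diff[abs_def] A_A_delta common_def conj_commute)
  moreover have "u y = 1" "u z = -1" using \<open>y \<noteq> z\<close> by (simp_all add: u_def)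
  ultimately show ?thesis
    using y z irrefl[OF y] irrefl[OF z] sym_iff[OF y z]
    by (simp add: q_def algebra_simps)
qed

text \<open>
  The lower bound on the entries of \<open>A\<^sup>2\<close> has row sum \<open>(r + s) a - r s + card S (a + r s)\<close>, and \<open>A\<^sup>2\<close>
  itself has row sum \<open>a\<^sup>2\<close>. The tightness equation says that these agree, so no entry can exceed
  its bound.
\<close>
lemma common_eq_of_tight:
  assumes lower: "\<And>f. (\<Sum>y\<in>S. f y) = 0 \<Longrightarrow> r * (\<Sum>y\<in>S. f y * f y) \<le> (\<Sum>y\<in>S. f y * A f y)"
    and upper: "\<And>f. (\<Sum>y\<in>S. f y) = 0 \<Longrightarrow> (\<Sum>y\<in>S. f y * A f y) \<le> s * (\<Sum>y\<in>S. f y * f y)"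
    and rs: "r < s" and tight: "real (card S) * (a + r * s) = (a - r) * (a - s)"
    and y: "y \<in> S" and z: "z \<in> S"
  shows "common y z = (r + s) * of_bool (E y z) - r * s * of_bool (y = z) + (a + r * s)"
proof -
  define \<beta> where "\<beta> t = common y t
    - ((r + s) * of_bool (E y t) - r * s * of_bool (y = t) + (a + r * s))" for t
  have "0 \<le> \<beta> t" if "t \<in> S" for t
  proof (cases "y = t")
    case True
    then show ?thesis using that by (simp add: \<beta>_def common_self irrefl)
  next
    case False
    then show ?thesis using common_lower_bound[OF lower upper rs y that] by (simp add: \<beta>_def)
  qed
  moreover have "(\<Sum>t\<in>S. \<beta> t) = 0"
  proof -
    have "(\<Sum>t\<in>S. of_bool (E y t)) = a"
      using A_const[OF y, of 1] by (simp add: adj_op_eq_sum[OF finite_S] del: sum_of_bool_eq)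
    moreover have "(\<Sum>t\<in>S. of_bool (y = t)) = (1::real)"
      using finite_S y by (simp add: of_bool_def)
    ultimately have "(\<Sum>t\<in>S. \<beta> t)
        = a * a - ((r + s) * a - r * s + real (card S) * (a + r * s))"
      unfolding \<beta>_def
      by (simp only: sum_subtractf sum.distrib sum_common[OF y] sum_constant flip: sum_distrib_left) (simp add: algebra_simps)
    then show ?thesis using tight by (simp add: algebra_simps)
  qed
  ultimately have "\<beta> z = 0"
    using finite_S z by (simp add: sum_nonneg_eq_0_iff)
  then show ?thesis by (simp add: \<beta>_def)
qed

lemma A_A_eq_sum_common:
  assumes "y \<in> S" shows "A (A f) y = (\<Sum>z\<in>S. common y z * f z)"
proof -
  have "A (A f) y = (\<Sum>w\<in>S. \<Sum>z\<in>S. of_bool (E y w) * of_bool (E z w) * f z)"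
    unfolding adj_op_eq_sum[OF finite_S, of E "A f" y]
    by (intro sum.cong refl) (simp add: adj_op_eq_sum[OF finite_S] sum_distrib_left sym_iff mult_ac)
  also have "\<dots> = (\<Sum>z\<in>S. common y z * f z)"
    by (subst sum.swap) (simp only: common_eq_sum sum_distrib_right)
  finally show ?thesis .
qed

text \<open>
  This is the entrywise identity \<open>A\<^sup>2 = \<alpha> A + \<beta> I + \<gamma> J\<close>, applied to \<open>f\<close>.
\<close>
lemma A_A_eq:
  assumes y: "y \<in> S"
    and c: "\<And>z. z \<in> S \<Longrightarrow> common y z = \<alpha> * of_bool (E y z) + \<beta> * of_bool (y = z) + \<gamma>"
  shows "A (A f) y = \<alpha> * A f y + \<beta> * f y + \<gamma> * (\<Sum>z\<in>S. f z)"
proof -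
  have "A (A f) y = (\<Sum>z\<in>S. \<alpha> * (of_bool (E y z) * f z) + \<beta> * (of_bool (z = y) * f z) + \<gamma> * f z)"
    unfolding A_A_eq_sum_common[OF y]
  proof (rule sum.cong[OF refl])
    fix z assume "z \<in> S"
    then show "common y z * f z
        = \<alpha> * (of_bool (E y z) * f z) + \<beta> * (of_bool (z = y) * f z) + \<gamma> * f z"
      by (simp only: c eq_commute[of z y] distrib_right mult.assoc)
  qed
  then show ?thesis
    by (simp only: sum.distrib sum_of_bool_times[OF finite_S y] adj_op_eq_sum[OF finite_S] flip: sum_distrib_left)
qed

lemma sum_eigenfunction_eq_0:
  assumes "\<And>y. y \<in> S \<Longrightarrow> A f y = t * f y" and "t \<noteq> a"
  shows "(\<Sum>y\<in>S. f y) = 0"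
proof -
  have "a * (\<Sum>y\<in>S. f y) = t * (\<Sum>y\<in>S. f y)"
    using sum_A[of f] assms(1) by (simp add: sum_distrib_left)
  then show ?thesis using \<open>t \<noteq> a\<close> by simp
qed

text \<open>
  On functions with sum zero the hypothesis reads \<open>(A - s) (A - r) = 0\<close>, so \<open>(A - r) w\<close> lies in the
  eigenspace of \<open>s\<close> for every such \<open>w\<close>. With \<open>w\<close> the difference of the point masses at the ends of an
  edge \<open>y z\<close>, its value at \<open>y\<close> is \<open>-1 - r\<close>, which is why \<open>r = -1\<close> is excluded.
\<close>
lemma eigenvalue_of_quadratic:
  assumes c: "\<And>y z. y \<in> S \<Longrightarrow> z \<in> S \<Longrightarrow>
      common y z = (r + s) * of_bool (E y z) - r * s * of_bool (y = z) + \<gamma>"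
    and y: "y \<in> S" and z: "z \<in> S" and "E y z" and "r \<noteq> - 1"
  obtains f where "f y \<noteq> 0" and "\<And>x. x \<in> S \<Longrightarrow> A f x = s * f x"
proof -
  define w :: "'a \<Rightarrow> real" where "w x = of_bool (x = y) - of_bool (x = z)" for x
  have Aw: "A w x = of_bool (E x y) - of_bool (E x z)" for x
    unfolding w_def[abs_def] by (simp add: A_diff A_delta y z)
  have "(\<Sum>x\<in>S. w x) = 0"
    using sum_of_bool_times[OF finite_S y, of "\<lambda>_. 1"] sum_of_bool_times[OF finite_S z, of "\<lambda>_. 1"]
    by (simp add: w_def sum_subtractf del: sum_of_bool_eq)
  then have AAw: "A (A w) x = (r + s) * A w x + - (r * s) * w x" if "x \<in> S" for x
    using A_A_eq[OF that, of "r + s" "- (r * s)" \<gamma> w] c[OF that] by simp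
  have "A (\<lambda>x. A w x - r * w x) x = s * (A w x - r * w x)" if "x \<in> S" for x
    unfolding A_diff A_scale AAw[OF that] by (simp add: algebra_simps)
  moreover have "y \<noteq> z" using \<open>E y z\<close> irrefl y by blast
  then have "w y = 1" by (simp add: w_def)
  moreover have "A w y = - 1" using \<open>E y z\<close> irrefl[OF y] by (simp add: Aw)
  ultimately show ?thesis using that[of "\<lambda>x. A w x - r * w x"] \<open>r \<noteq> - 1\<close> by simp
qed

end

section \<open>Distance-regular metrics and their cosine sequences\<close>

text \<open>
  A square matrix with orthonormal rows has orthonormal columns. This is the only place where the
  dimension \<open>d + 1\<close> is used, and with it the fact that there are as many eigenvalues as distances.
\<close>
lemma orthonormal_rows_imp_columns:
  fixes u :: "nat \<Rightarrow> nat \<Rightarrow> real"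
  assumes "\<And>j j'. j \<le> d \<Longrightarrow> j' \<le> d \<Longrightarrow> (\<Sum>i\<le>d. u j i * u j' i) = of_bool (j = j')"
    and "i \<le> d" "i' \<le> d"
  shows "(\<Sum>j\<le>d. u j i * u j i') = of_bool (i = i')"
proof -
  define U where "U = mat (Suc d) (Suc d) (\<lambda>(j, i). u j i)"
  have U: "U \<in> carrier_mat (Suc d) (Suc d)" by (simp add: U_def)
  have "U * transpose_mat U = 1\<^sub>m (Suc d)"
    using assms(1) by (intro eq_matI)
      (auto simp: U_def scalar_prod_def atLeast0LessThan lessThan_Suc_atMost)
  then have "transpose_mat U * U = 1\<^sub>m (Suc d)"
    using mat_mult_left_right_inverse[OF U transpose_carrier_mat[THEN iffD2, OF U]] by blast
  then have "(transpose_mat U * U) $$ (i, i') = of_bool (i = i')" using assms by simp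
  then show ?thesis
    using assms(2,3) by (simp add: U_def scalar_prod_def atLeast0LessThan lessThan_Suc_atMost)
qed

text \<open>
  The parts of distance-regularity that the spectral arguments use, stated for the distance function
  alone: an integral metric in which distances are attained along geodesics, and in which the numbers
  of points at prescribed distances from two points depend only on the distance of these.
\<close>
locale distance_regular_metric =
  fixes V :: "'a set" and D :: "'a \<Rightarrow> 'a \<Rightarrow> nat" and d :: nat
    and p :: "nat \<Rightarrow> nat \<Rightarrow> nat \<Rightarrow> nat"
  assumes finite_V: "finite V"
    and D_eq_0_iff: "\<And>x y. x \<in> V \<Longrightarrow> y \<in> V \<Longrightarrow> D x y = 0 \<longleftrightarrow> x = y"
    and D_sym: "\<And>x y. x \<in> V \<Longrightarrow> y \<in> V \<Longrightarrow> D x y = D y x"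
    and D_triangle: "\<And>x y z. x \<in> V \<Longrightarrow> y \<in> V \<Longrightarrow> z \<in> V \<Longrightarrow> D x z \<le> D x y + D y z"
    and D_le: "\<And>x y. x \<in> V \<Longrightarrow> y \<in> V \<Longrightarrow> D x y \<le> d"
    and D_geodesic: "\<And>x z i. x \<in> V \<Longrightarrow> z \<in> V \<Longrightarrow> D x z = Suc i \<Longrightarrow> \<exists>y\<in>V. D x y = i \<and> D y z = 1"
    and D_attained: "\<exists>x\<in>V. \<exists>y\<in>V. D x y = d"
    and three_le_d: "3 \<le> d"
    and card_eq_p: "\<And>x y i j. x \<in> V \<Longrightarrow> y \<in> V \<Longrightarrow> i \<le> d \<Longrightarrow> j \<le> d \<Longrightarrow>
      card {w \<in> V. D x w = i \<and> D y w = j} = p (D x y) i j"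
begin

text \<open>
  The matrix \<open>P\<close> is tridiagonal with rows \<open>c\<^sub>i, a\<^sub>i, b\<^sub>i\<close>; it is kept as a full matrix so that
  recurrences at the two ends \<open>0\<close> and \<open>d\<close> need no separate treatment.
\<close>
definition P :: "nat \<Rightarrow> nat \<Rightarrow> real" where "P i h = real (p i h 1)"

definition sphere_size :: "nat \<Rightarrow> real" where "sphere_size i = real (p 0 i i)"

abbreviation k :: real where "k \<equiv> P 0 1"
abbreviation a :: real where "a \<equiv> P 1 1"
abbreviation b :: real where "b \<equiv> P 1 2"

text \<open>
  The recurrence says that \<open>z \<mapsto> \<omega> (D x z)\<close> is an eigenfunction for \<open>\<theta>\<close>, for every base point \<open>x\<close>.
\<close>
definition cosine_sequence :: "real \<Rightarrow> (nat \<Rightarrow> real) \<Rightarrow> bool" where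
  "cosine_sequence \<theta> \<omega> \<longleftrightarrow> \<omega> 0 = 1 \<and> (\<forall>i\<le>d. (\<Sum>h\<le>d. P i h * \<omega> h) = \<theta> * \<omega> i)"

lemma D_self: "x \<in> V \<Longrightarrow> D x x = 0"
  by (simp add: D_eq_0_iff)

lemma exists_pair:
  assumes "i \<le> d" obtains x y where "x \<in> V" "y \<in> V" "D x y = i"
proof -
  have "\<exists>x\<in>V. \<exists>y\<in>V. D x y = i"
    using assms
  proof (induction rule: inc_induct)
    case base then show ?case by (rule D_attained)
  next
    case (step n) then show ?case using D_geodesic by blast
  qed
  then show ?thesis using that by blast
qed

lemma sum_over_pairs_of_distances:
  assumes x: "x \<in> V" and y: "y \<in> V"
  shows "(\<Sum>w\<in>V. \<phi> (D x w) (D y w)) = (\<Sum>i\<le>d. \<Sum>j\<le>d. real (p (D x y) i j) * \<phi> i j)"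
proof -
  have "(\<Sum>w\<in>V. \<phi> (D x w) (D y w))
      = (\<Sum>ij\<in>{..d}\<times>{..d}. \<Sum>w\<in>{w\<in>V. (D x w, D y w) = ij}. \<phi> (D x w) (D y w))"
    by (rule sum.group[symmetric]) (auto simp: finite_V D_le x y)
  also have "\<dots> = (\<Sum>ij\<in>{..d}\<times>{..d}. real (p (D x y) (fst ij) (snd ij)) * \<phi> (fst ij) (snd ij))"
    by (rule sum.cong) (auto simp flip: card_eq_p[OF x y])
  finally show ?thesis by (simp add: sum.cartesian_product case_prod_unfold)
qed

lemma sum_over_neighbours:
  assumes x: "x \<in> V" and y: "y \<in> V"
  shows "(\<Sum>w | w \<in> V \<and> D y w = 1. g (D x w)) = (\<Sum>h\<le>d. P (D x y) h * g h)"
proof -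
  have "(\<Sum>w | w \<in> V \<and> D y w = 1. g (D x w)) = (\<Sum>w\<in>V. of_bool (D y w = 1) * g (D x w))"
    using finite_V by (intro sum.mono_neutral_cong_left) auto
  also have "\<dots> = (\<Sum>h\<le>d. \<Sum>j\<le>d. of_bool (j = 1) * (real (p (D x y) h j) * g h))"
    using sum_over_pairs_of_distances[OF x y, of "\<lambda>h j. of_bool (j = 1) * g h"]
    by (simp add: mult_ac)
  also have "\<dots> = (\<Sum>h\<le>d. P (D x y) h * g h)"
    using three_le_d by (intro sum.cong refl) (simp add: sum_of_bool_times P_def)
  finally show ?thesis .
qed

lemma p_swap:
  assumes "h \<le> d" "i \<le> d" "j \<le> d" shows "p h i j = p h j i"
proof -
  obtain x y where xy: "x \<in> V" "y \<in> V" "D x y = h" using exists_pair assms by blast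
  have "{w \<in> V. D x w = i \<and> D y w = j} = {w \<in> V. D y w = j \<and> D x w = i}" by auto
  then show ?thesis using card_eq_p[of x y i j] card_eq_p[of y x j i] xy assms D_sym[of y x] by simp
qed

lemma card_sphere: "x \<in> V \<Longrightarrow> i \<le> d \<Longrightarrow> real (card {w \<in> V. D x w = i}) = sphere_size i"
  using card_eq_p[of x x i i] by (simp add: sphere_size_def D_self)

lemma sum_over_spheres:
  assumes x: "x \<in> V"
  shows "(\<Sum>w\<in>V. g (D x w)) = (\<Sum>i\<le>d. sphere_size i * g i)"
proof -
  have "(\<Sum>w\<in>V. g (D x w)) = (\<Sum>i\<le>d. \<Sum>w\<in>{w\<in>V. D x w = i}. g (D x w))"
    by (rule sum.group[symmetric]) (auto simp: finite_V D_le x)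
  also have "\<dots> = (\<Sum>i\<le>d. sphere_size i * g i)"
    using x by (intro sum.cong refl) (simp flip: card_sphere[OF x])
  finally show ?thesis .
qed

lemma sphere_size_0: "sphere_size 0 = 1"
proof -
  obtain x where "x \<in> V" using exists_pair[of 0] by blast
  moreover have "{w \<in> V. D x w = 0} = {x}" using \<open>x \<in> V\<close> by (auto simp: D_eq_0_iff)
  ultimately show ?thesis using card_sphere[of x 0] by simp
qed

lemma sphere_size_1: "sphere_size 1 = k"
  by (simp add: sphere_size_def P_def)

lemma sphere_size_pos:
  assumes "i \<le> d" shows "0 < sphere_size i"
proof -
  obtain x y where "x \<in> V" "y \<in> V" "D x y = i" using exists_pair assms by blast
  then have "card {w \<in> V. D x w = i} > 0" using finite_V by (auto simp: card_gt_0_iff)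
  then show ?thesis using card_sphere[OF \<open>x \<in> V\<close> assms] by simp
qed

lemma P_nonneg: "0 \<le> P i h"
  by (simp add: P_def)

lemma P_eq_card:
  assumes "x \<in> V" "y \<in> V" "h \<le> d"
  shows "P (D x y) h = real (card {w \<in> V. D x w = h \<and> D y w = 1})"
  using card_eq_p[of x y h 1] assms three_le_d by (simp add: P_def)

lemma P_upper_pos:
  assumes "i < d" shows "0 < P i (Suc i)"
proof -
  obtain x z where xz: "x \<in> V" "z \<in> V" "D x z = Suc i" using exists_pair[of "Suc i"] assms by auto
  then obtain y where "y \<in> V" "D x y = i" "D y z = 1" using D_geodesic by blast
  then have "card {w \<in> V. D x w = Suc i \<and> D y w = 1} > 0"
    using xz finite_V by (auto simp: card_gt_0_iff)
  then show ?thesis using P_eq_card[of x y "Suc i"] \<open>y \<in> V\<close> \<open>D x y = i\<close> xz assms by simp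
qed

lemma P_eq_0:
  assumes "i \<le> d" "h \<le> d" "Suc i < h \<or> Suc h < i" shows "P i h = 0"
proof -
  obtain x y where xy: "x \<in> V" "y \<in> V" "D x y = i" using exists_pair assms by blast
  have "D x w \<le> Suc i \<and> i \<le> Suc (D x w)" if "w \<in> V" "D y w = 1" for w
    using D_triangle[of x y w] D_triangle[of x w y] D_sym[of w y] that xy by simp
  then have "{w \<in> V. D x w = h \<and> D y w = 1} = {}" using assms(3) by fastforce
  then have "card {w \<in> V. D x w = h \<and> D y w = 1} = 0" by (simp only: card.empty)
  then show ?thesis using P_eq_card[of x y h] xy assms by simp
qed

lemma P_0: assumes "h \<le> d" "h \<noteq> 1" shows "P 0 h = 0"
proof -
  obtain x where x: "x \<in> V" using exists_pair[of 0] by blast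
  have "{w \<in> V. D x w = h \<and> D x w = 1} = {}" using assms(2) by auto
  then have "card {w \<in> V. D x w = h \<and> D x w = 1} = 0" by (simp only: card.empty)
  then show ?thesis using P_eq_card[of x x h] x assms by (simp add: D_self)
qed

lemma P_1_0: "P 1 0 = 1"
proof -
  obtain x y where xy: "x \<in> V" "y \<in> V" "D x y = 1" using exists_pair[of 1] three_le_d by auto
  then have "{w \<in> V. D x w = 0 \<and> D y w = 1} = {x}" by (auto simp: D_eq_0_iff D_sym)
  then show ?thesis using P_eq_card[of x y 0] xy by simp
qed

lemma P_row_sum: assumes "i \<le> d" shows "(\<Sum>h\<le>d. P i h) = k"
proof -
  obtain x y where xy: "x \<in> V" "y \<in> V" "D x y = i" using exists_pair assms by blast
  then show ?thesis
    using sum_over_neighbours[of x y "\<lambda>_. 1"] card_sphere[of y 1] three_le_d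
    unfolding sphere_size_1 by simp
qed

lemma sum_P_0: "(\<Sum>h\<le>d. P 0 h * g h) = k * g 1"
proof -
  have "(\<Sum>h\<le>d. P 0 h * g h) = (\<Sum>h\<in>{1}. P 0 h * g h)"
    using three_le_d by (intro sum.mono_neutral_right) (auto simp: P_0)
  then show ?thesis by simp
qed

lemma sum_P_1: "(\<Sum>h\<le>d. P 1 h * g h) = g 0 + a * g 1 + b * g 2"
proof -
  have "(\<Sum>h\<le>d. P 1 h * g h) = (\<Sum>h\<in>{0,1,2}. P 1 h * g h)"
    using three_le_d by (intro sum.mono_neutral_right) (auto simp: P_eq_0)
  then show ?thesis using P_1_0 by simp
qed

lemma k_eq: "k = 1 + a + b"
  using sum_P_1[of "\<lambda>_. 1"] P_row_sum[of 1] three_le_d by simp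

lemma a_nonneg: "0 \<le> a" by (rule P_nonneg)

lemma b_pos: "0 < b"
  using P_upper_pos[of 1] three_le_d by (simp add: numeral_2_eq_2)

lemma k_pos: "0 < k"
  using k_eq a_nonneg b_pos by simp

text \<open>
  Both sides count the adjacent pairs \<open>(y, z)\<close> with \<open>y\<close> at distance \<open>h\<close> and \<open>z\<close> at distance \<open>i\<close> from a
  fixed point. Thus \<open>P\<close> is self-adjoint for the inner product weighted by the sphere sizes.
\<close>
subsection \<open>Cosine sequences\<close>

lemma detailed_balance:
  assumes h: "h \<le> d" and i: "i \<le> d"
  shows "sphere_size h * P h i = sphere_size i * P i h"
proof -
  obtain x where x: "x \<in> V" using exists_pair[of 0] by blast
  have *: "sphere_size h * P h i = (\<Sum>y | y \<in> V \<and> D x y = h. \<Sum>z | z \<in> V \<and> D x z = i. of_bool (D y z = 1))"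
    if "h \<le> d" "i \<le> d" for h i
  proof -
    have "(\<Sum>z | z \<in> V \<and> D x z = i. of_bool (D y z = 1)) = P h i" if y: "y \<in> V \<and> D x y = h" for y
    proof -
      have "{z. z \<in> V \<and> D x z = i} \<inter> {z. D y z = 1} = {z \<in> V. D x z = i \<and> D y z = 1}" by auto
      then show ?thesis using P_eq_card[of x y i] y x \<open>i \<le> d\<close> finite_V by simp
    qed
    then show ?thesis using card_sphere[OF x \<open>h \<le> d\<close>] by (simp del: sum_of_bool_eq)
  qed
  have "(\<Sum>y | y \<in> V \<and> D x y = h. \<Sum>z | z \<in> V \<and> D x z = i. of_bool (D y z = 1))
      = (\<Sum>z | z \<in> V \<and> D x z = i. \<Sum>y | y \<in> V \<and> D x y = h. (of_bool (D z y = 1)::real))"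
    by (subst sum.swap) (intro sum.cong refl, auto simp: D_sym)
  then show ?thesis using *[OF h i] *[OF i h] by simp
qed

text \<open>
  Row \<open>j\<close> of the recurrence determines the value at \<open>j + 1\<close> from the earlier ones because
  \<open>b\<^sub>j = P j (j + 1)\<close> is positive.
\<close>
lemma recurrence_unique:
  assumes \<omega>: "cosine_sequence \<theta> \<omega>"
    and g: "\<And>i. i \<le> d \<Longrightarrow> (\<Sum>h\<le>d. P i h * g h) = \<theta> * g i"
    and "i \<le> d"
  shows "g i = g 0 * \<omega> i"
proof -
  define e where "e i = g i - g 0 * \<omega> i" for i
  have e: "(\<Sum>h\<le>d. P i h * e h) = \<theta> * e i" if "i \<le> d" for i
  proof -
    have "(\<Sum>h\<le>d. P i h * e h) = (\<Sum>h\<le>d. P i h * g h) - g 0 * (\<Sum>h\<le>d. P i h * \<omega> h)"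
      by (simp add: e_def right_diff_distrib sum_subtractf sum_distrib_left mult_ac)
    then show ?thesis using \<omega> g that by (simp add: cosine_sequence_def e_def algebra_simps)
  qed
  have "e i = 0" using \<open>i \<le> d\<close>
  proof (induction i rule: less_induct)
    case (less i)
    show ?case
    proof (cases i)
      case 0
      then show ?thesis using \<omega> by (simp add: e_def cosine_sequence_def)
    next
      case (Suc j)
      have "(\<Sum>h\<le>d. P j h * e h) = (\<Sum>h\<in>{Suc j}. P j h * e h)"
      proof (intro sum.mono_neutral_right ballI)
        fix h assume h: "h \<in> {..d} - {Suc j}"
        show "P j h * e h = 0"
        proof (cases "h < Suc j")
          case True
          then show ?thesis using less Suc by simp
        next
          case False
          then show ?thesis using P_eq_0[of j h] h Suc less.prems by simp
        qed
      qed (use Suc less.prems in auto)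
      moreover have "e j = 0" using less Suc by simp
      ultimately have "P j (Suc j) * e (Suc j) = 0" using e[of j] Suc less.prems by simp
      then show ?thesis using P_upper_pos[of j] Suc less.prems by simp
    qed
  qed
  then show ?thesis by (simp add: e_def)
qed

text \<open>
  The cosines are the averages of an eigenfunction over the spheres around a point \<open>x\<close> at which it
  does not vanish, divided by its value at \<open>x\<close>.
\<close>
lemma cosine_sequence_exists:
  assumes x: "x \<in> V" and "f x \<noteq> 0"
    and f: "\<And>y. y \<in> V \<Longrightarrow> adj_op V (\<lambda>y z. D y z = 1) f y = \<theta> * f y"
  obtains \<omega> where "cosine_sequence \<theta> \<omega>"
proof -
  define T where "T i = (\<Sum>y | y \<in> V \<and> D x y = i. f y)" for i
  define \<omega> where "\<omega> i = T i / (sphere_size i * f x)" for i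
  have T: "T i = sphere_size i * f x * \<omega> i" if "i \<le> d" for i
    using sphere_size_pos[OF that] \<open>f x \<noteq> 0\<close> by (simp add: \<omega>_def)
  have "(\<Sum>h\<le>d. P i h * \<omega> h) = \<theta> * \<omega> i" if i: "i \<le> d" for i
  proof -
    have "\<theta> * T i = (\<Sum>y | y \<in> V \<and> D x y = i. adj_op V (\<lambda>y z. D y z = 1) f y)"
      unfolding T_def sum_distrib_left by (intro sum.cong refl) (use f in auto)
    also have "\<dots> = (\<Sum>y | y \<in> V \<and> D x y = i. \<Sum>z\<in>V. of_bool (D y z = 1) * f z)"
      by (simp add: adj_op_eq_sum[OF finite_V])
    also have "\<dots> = (\<Sum>z\<in>V. \<Sum>y | y \<in> V \<and> D x y = i. of_bool (D z y = 1) * f z)"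
      by (subst sum.swap) (intro sum.cong refl, auto simp: D_sym)
    also have "\<dots> = (\<Sum>z\<in>V. P (D x z) i * f z)"
    proof (rule sum.cong[OF refl])
      fix z assume z: "z \<in> V"
      have "{y. y \<in> V \<and> D x y = i} \<inter> {y. D z y = 1} = {y \<in> V. D x y = i \<and> D z y = 1}" by auto
      then show "(\<Sum>y | y \<in> V \<and> D x y = i. of_bool (D z y = 1) * f z) = P (D x z) i * f z"
        using P_eq_card[OF x z i] finite_V by (simp flip: sum_distrib_right)
    qed
    also have "\<dots> = (\<Sum>h\<le>d. \<Sum>z\<in>{z\<in>V. D x z = h}. P (D x z) i * f z)"
      by (rule sum.group[symmetric]) (auto simp: finite_V D_le x)
    also have "\<dots> = (\<Sum>h\<le>d. P h i * T h)"
      by (intro sum.cong refl) (auto simp: T_def sum_distrib_left intro!: sum.cong)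
    also have "\<dots> = (\<Sum>h\<le>d. (sphere_size h * P h i) * (f x * \<omega> h))"
      by (intro sum.cong refl) (simp add: T)
    also have "\<dots> = sphere_size i * f x * (\<Sum>h\<le>d. P i h * \<omega> h)"
      unfolding sum_distrib_left
      by (intro sum.cong refl) (simp add: detailed_balance[OF _ i])
    finally show ?thesis using sphere_size_pos[OF i] \<open>f x \<noteq> 0\<close> by (simp add: T[OF i])
  qed
  moreover have "{y. y \<in> V \<and> D x y = 0} = {x}" using x by (auto simp: D_eq_0_iff)
  then have "\<omega> 0 = 1" using \<open>f x \<noteq> 0\<close> by (simp add: \<omega>_def T_def sphere_size_0)
  ultimately show ?thesis using that by (auto simp: cosine_sequence_def)
qed

subsection \<open>Positivity of the cosine matrices\<close>

definition cosine_norm :: "(nat \<Rightarrow> real) \<Rightarrow> real" where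
  "cosine_norm \<omega> = (\<Sum>i\<le>d. sphere_size i * (\<omega> i * \<omega> i))"

lemma cosine_norm_pos:
  assumes "cosine_sequence \<theta> \<omega>" shows "0 < cosine_norm \<omega>"
proof -
  have "0 < sphere_size 0 * (\<omega> 0 * \<omega> 0)"
    using assms by (simp add: cosine_sequence_def sphere_size_0)
  moreover have "0 \<le> sphere_size i * (\<omega> i * \<omega> i)" for i by (simp add: sphere_size_def)
  ultimately show ?thesis unfolding cosine_norm_def by (intro sum_pos2[of _ 0]) auto
qed

text \<open>
  The matrix \<open>M\<close> with entries \<open>\<omega> (D x y)\<close> satisfies \<open>M\<^sup>2 = n M\<close> with \<open>n > 0\<close>. Indeed the entries of \<open>M\<^sup>2\<close>
  depend only on the distance, and the columns of \<open>M\<close>, hence of \<open>M\<^sup>2\<close>, are eigenfunctions for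
  \<open>\<theta>\<close>; so the entries of \<open>M\<^sup>2\<close> obey the recurrence of \<open>\<omega>\<close> and are proportional to it.
\<close>
lemma cosine_matrix_square:
  assumes \<omega>: "cosine_sequence \<theta> \<omega>" and x: "x \<in> V" and y: "y \<in> V"
  shows "(\<Sum>w\<in>V. \<omega> (D x w) * \<omega> (D y w)) = cosine_norm \<omega> * \<omega> (D x y)"
proof -
  define g where "g h = (\<Sum>i\<le>d. \<Sum>j\<le>d. real (p h i j) * (\<omega> i * \<omega> j))" for h
  have g: "(\<Sum>w\<in>V. \<omega> (D x w) * \<omega> (D y w)) = g (D x y)" if "x \<in> V" "y \<in> V" for x y
    using sum_over_pairs_of_distances[OF that, of "\<lambda>i j. \<omega> i * \<omega> j"] by (simp add: g_def)
  have "(\<Sum>h\<le>d. P i h * g h) = \<theta> * g i" if i: "i \<le> d" for i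
  proof -
    obtain x y where xy: "x \<in> V" "y \<in> V" "D x y = i" using exists_pair i by blast
    have "(\<Sum>h\<le>d. P i h * g h) = (\<Sum>w | w \<in> V \<and> D y w = 1. g (D x w))"
      using sum_over_neighbours[of x y g] xy by simp
    also have "\<dots> = (\<Sum>w | w \<in> V \<and> D y w = 1. \<Sum>u\<in>V. \<omega> (D x u) * \<omega> (D u w))"
    proof (rule sum.cong[OF refl])
      fix w assume "w \<in> {w. w \<in> V \<and> D y w = 1}"
      then have w: "w \<in> V" by simp
      have "(\<Sum>u\<in>V. \<omega> (D x u) * \<omega> (D u w)) = (\<Sum>u\<in>V. \<omega> (D x u) * \<omega> (D w u))"
        using w by (intro sum.cong refl) (simp add: D_sym[of w])
      then show "g (D x w) = (\<Sum>u\<in>V. \<omega> (D x u) * \<omega> (D u w))"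
        using g[OF xy(1) w] by simp
    qed
    also have "\<dots> = (\<Sum>u\<in>V. \<omega> (D x u) * (\<Sum>w | w \<in> V \<and> D y w = 1. \<omega> (D u w)))"
      by (subst sum.swap) (simp add: sum_distrib_left)
    also have "\<dots> = (\<Sum>u\<in>V. \<theta> * (\<omega> (D x u) * \<omega> (D y u)))"
    proof (rule sum.cong[OF refl])
      fix u assume u: "u \<in> V"
      have "(\<Sum>w | w \<in> V \<and> D y w = 1. \<omega> (D u w)) = \<theta> * \<omega> (D u y)"
        using sum_over_neighbours[OF u xy(2), of \<omega>] \<omega> D_le[OF u xy(2)]
        unfolding cosine_sequence_def by simp
      then show "\<omega> (D x u) * (\<Sum>w | w \<in> V \<and> D y w = 1. \<omega> (D u w)) = \<theta> * (\<omega> (D x u) * \<omega> (D y u))"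
        using D_sym[OF u xy(2)] by simp
    qed
    finally show ?thesis using g[of x y] xy by (simp flip: sum_distrib_left)
  qed
  then have "g (D x y) = g 0 * \<omega> (D x y)"
    using recurrence_unique[OF \<omega>] D_le[OF x y] by blast
  moreover have "g 0 = cosine_norm \<omega>"
    using g[OF x x] sum_over_spheres[OF x, of "\<lambda>i. \<omega> i * \<omega> i"] x
    by (simp add: D_self cosine_norm_def)
  ultimately show ?thesis using g[OF x y] by simp
qed

text \<open>
  With \<open>M\<close> as above, \<open>n v\<^sup>T M v = v\<^sup>T M\<^sup>2 v = \<parallel>M v\<parallel>\<^sup>2\<close>, for \<open>v\<close> supported on \<open>S\<close>. Besides positivity
  this shows that \<open>M v = 0\<close> as soon as the form vanishes at \<open>v\<close>.
\<close>
lemma cosine_form_eq_square: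
  assumes \<omega>: "cosine_sequence \<theta> \<omega>" and S: "S \<subseteq> V"
  shows "cosine_norm \<omega> * (\<Sum>y\<in>S. \<Sum>z\<in>S. \<omega> (D y z) * (v y * v z))
    = (\<Sum>w\<in>V. (\<Sum>z\<in>S. \<omega> (D w z) * v z)\<^sup>2)"
proof -
  have "(\<Sum>w\<in>V. (\<Sum>z\<in>S. \<omega> (D w z) * v z)\<^sup>2)
      = (\<Sum>w\<in>V. \<Sum>y\<in>S. \<Sum>z\<in>S. \<omega> (D w y) * \<omega> (D w z) * (v y * v z))"
    by (simp add: power2_eq_square sum_product mult_ac)
  also have "\<dots> = (\<Sum>y\<in>S. \<Sum>w\<in>V. \<Sum>z\<in>S. \<omega> (D w y) * \<omega> (D w z) * (v y * v z))"
    by (rule sum.swap)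
  also have "\<dots> = (\<Sum>y\<in>S. \<Sum>z\<in>S. \<Sum>w\<in>V. \<omega> (D w y) * \<omega> (D w z) * (v y * v z))"
    by (intro sum.cong refl sum.swap)
  also have "\<dots> = (\<Sum>y\<in>S. \<Sum>z\<in>S. cosine_norm \<omega> * \<omega> (D y z) * (v y * v z))"
  proof (intro sum.cong refl)
    fix y z assume "y \<in> S" "z \<in> S"
    then have yz: "y \<in> V" "z \<in> V" using S by auto
    have "(\<Sum>w\<in>V. \<omega> (D w y) * \<omega> (D w z)) = (\<Sum>w\<in>V. \<omega> (D y w) * \<omega> (D z w))"
      using yz by (intro sum.cong refl) (simp add: D_sym)
    then show "(\<Sum>w\<in>V. \<omega> (D w y) * \<omega> (D w z) * (v y * v z))
        = cosine_norm \<omega> * \<omega> (D y z) * (v y * v z)"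
      using cosine_matrix_square[OF \<omega> yz] by (simp flip: sum_distrib_right)
  qed
  finally show ?thesis by (simp add: sum_distrib_left mult_ac)
qed

lemma cosine_form_nonneg:
  assumes "cosine_sequence \<theta> \<omega>" and "S \<subseteq> V"
  shows "0 \<le> (\<Sum>y\<in>S. \<Sum>z\<in>S. \<omega> (D y z) * (v y * v z))"
proof -
  have "0 \<le> cosine_norm \<omega> * (\<Sum>y\<in>S. \<Sum>z\<in>S. \<omega> (D y z) * (v y * v z))"
    by (simp add: cosine_form_eq_square[OF assms] sum_nonneg)
  then show ?thesis using cosine_norm_pos[OF assms(1)] by (simp add: zero_le_mult_iff)
qed

lemma cosine_1:
  assumes "cosine_sequence \<theta> \<omega>" shows "k * \<omega> 1 = \<theta>"
  using assms sum_P_0[of \<omega>] by (simp add: cosine_sequence_def)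

lemma cosine_differences:
  assumes "cosine_sequence \<theta> \<omega>"
  shows "b * (\<omega> 1 - \<omega> 2) = (1 + \<theta>) * (1 - \<omega> 1)"
    and "b * (1 - \<omega> 2) = (b + 1 + \<theta>) * (1 - \<omega> 1)"
proof -
  have "1 + a * \<omega> 1 + b * \<omega> 2 = \<theta> * \<omega> 1"
    using assms sum_P_1[of \<omega>] three_le_d by (simp add: cosine_sequence_def)
  moreover have "(1 + a + b) * \<omega> 1 = \<theta>" using cosine_1[OF assms] k_eq by simp
  ultimately show "b * (\<omega> 1 - \<omega> 2) = (1 + \<theta>) * (1 - \<omega> 1)"
    and "b * (1 - \<omega> 2) = (b + 1 + \<theta>) * (1 - \<omega> 1)"
    by (simp_all add: algebra_simps)
qed

lemma cosine_form_pair: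
  fixes t :: real
  assumes "cosine_sequence \<theta> \<omega>" "y \<in> V" "z \<in> V" "y \<noteq> z"
  defines "v \<equiv> \<lambda>u. if u = y then 1 else t"
  shows "(\<Sum>y'\<in>{y,z}. \<Sum>z'\<in>{y,z}. \<omega> (D y' z') * (v y' * v z')) = 1 + 2 * t * \<omega> (D y z) + t\<^sup>2"
  using assms D_sym[of z y]
  by (simp add: v_def D_self cosine_sequence_def power2_eq_square)

lemma abs_cosine_le_1:
  assumes \<omega>: "cosine_sequence \<theta> \<omega>" and "i \<le> d"
  shows "\<bar>\<omega> i\<bar> \<le> 1"
proof -
  obtain y z where yz: "y \<in> V" "z \<in> V" "D y z = i" using exists_pair \<open>i \<le> d\<close> by blast
  show ?thesis
  proof (cases "y = z")
    case True
    then show ?thesis using yz \<omega> by (simp add: D_self cosine_sequence_def)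
  next
    case False
    have "0 \<le> 1 + 2 * t * \<omega> i + t\<^sup>2" for t
      using cosine_form_nonneg[OF \<omega>, of "{y,z}" "\<lambda>u. if u = y then 1 else t"]
        cosine_form_pair[OF \<omega> yz(1,2) False, of t] yz by simp
    from this[of 1] this[of "-1"] show ?thesis by simp
  qed
qed

lemma abs_eigenvalue_le:
  assumes "cosine_sequence \<theta> \<omega>" shows "\<bar>\<theta>\<bar> \<le> k"
  using cosine_1[OF assms] abs_cosine_le_1[OF assms, of 1] three_le_d k_pos
  by (auto simp: abs_mult mult_le_cancel_left1)

text \<open>
  For \<open>\<theta> = -k\<close> the first cosine is \<open>-1\<close>, so the cosine form vanishes at the sum of the point masses
  of two adjacent points. Therefore the cosine matrix annihilates this sum: the cosine, taken from
  any base point, changes its sign along every edge. It never vanishes, hence no edge joins two points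
  at the same distance from a third one.
\<close>
lemma bipartite_of_minus_valency:
  assumes \<omega>: "cosine_sequence (- k) \<omega>" and i: "i \<le> d"
  shows "P i i = 0"
proof -
  have \<omega>1: "\<omega> 1 = -1" using cosine_1[OF \<omega>] k_pos
    by (metis less_irrefl mult_cancel_left mult_minus1_right)
  have flip: "\<omega> (D w z) = - \<omega> (D w y)" if "w \<in> V" "y \<in> V" "z \<in> V" "D y z = 1" for w y z
  proof -
    have "y \<noteq> z" using that by (auto simp: D_self)
    have "(\<Sum>w\<in>V. (\<Sum>u\<in>{y,z}. \<omega> (D w u) * (if u = y then 1 else 1))\<^sup>2) = 0"
      using cosine_form_eq_square[OF \<omega>, of "{y,z}" "\<lambda>u. if u = y then 1 else 1"]
        cosine_form_pair[OF \<omega> that(2,3) \<open>y \<noteq> z\<close>, of 1] that \<omega>1 by simp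
    then have "(\<Sum>u\<in>{y,z}. \<omega> (D w u) * (if u = y then 1 else 1))\<^sup>2 = 0"
      using finite_V \<open>w \<in> V\<close> by (subst (asm) sum_nonneg_eq_0_iff) auto
    then show ?thesis using \<open>y \<noteq> z\<close> by simp
  qed
  have nz: "\<omega> j \<noteq> 0" if "j \<le> d" for j
    using that
  proof (induction j)
    case 0 then show ?case using \<omega> by (simp add: cosine_sequence_def)
  next
    case (Suc j)
    then obtain x z where xz: "x \<in> V" "z \<in> V" "D x z = Suc j" using exists_pair[of "Suc j"] by auto
    then obtain y where "y \<in> V" "D x y = j" "D y z = 1" using D_geodesic by blast
    then show ?case using flip[of x y z] xz Suc by simp
  qed
  obtain x y where xy: "x \<in> V" "y \<in> V" "D x y = i" using exists_pair i by blast
  have "{w \<in> V. D x w = i \<and> D y w = 1} = {}"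
    using flip[OF xy(1,2)] nz[OF i] xy by fastforce
  then have "card {w \<in> V. D x w = i \<and> D y w = 1} = 0" by (simp only: card.empty)
  then show ?thesis using P_eq_card[of x y i] xy i by simp
qed

text \<open>
  Eigenvectors of the self-adjoint matrix \<open>P\<close> for distinct eigenvalues.
\<close>
subsection \<open>Completeness of the cosine sequences\<close>

lemma cosines_orthogonal:
  assumes \<omega>: "cosine_sequence \<theta> \<omega>" and \<omega>': "cosine_sequence \<theta>' \<omega>'" and "\<theta> \<noteq> \<theta>'"
  shows "(\<Sum>i\<le>d. sphere_size i * (\<omega> i * \<omega>' i)) = 0"
proof -
  have "\<theta> * (\<Sum>i\<le>d. sphere_size i * (\<omega> i * \<omega>' i))
      = (\<Sum>i\<le>d. sphere_size i * \<omega>' i * (\<Sum>h\<le>d. P i h * \<omega> h))"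
    using \<omega> by (simp add: cosine_sequence_def sum_distrib_left mult_ac)
  also have "\<dots> = (\<Sum>i\<le>d. \<Sum>h\<le>d. (sphere_size i * P i h) * (\<omega>' i * \<omega> h))"
    by (simp add: sum_distrib_left mult_ac)
  also have "\<dots> = (\<Sum>h\<le>d. \<Sum>i\<le>d. (sphere_size h * P h i) * (\<omega>' i * \<omega> h))"
    by (subst sum.swap) (intro sum.cong refl, simp add: detailed_balance)
  also have "\<dots> = (\<Sum>h\<le>d. sphere_size h * \<omega> h * (\<Sum>i\<le>d. P h i * \<omega>' i))"
    by (simp add: sum_distrib_left mult_ac)
  also have "\<dots> = \<theta>' * (\<Sum>i\<le>d. sphere_size i * (\<omega> i * \<omega>' i))"
    using \<omega>' by (simp add: cosine_sequence_def sum_distrib_left mult_ac)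
  finally show ?thesis using \<open>\<theta> \<noteq> \<theta>'\<close> by simp
qed

text \<open>
  The identity matrix as a positive combination of the cosine matrices. The \<open>d + 1\<close> cosine sequences
  are orthogonal, so after normalisation they are the rows of an orthogonal matrix; the claim is the
  orthogonality of its column \<open>i\<close> to its column \<open>0\<close>.
\<close>
lemma sum_cosines_eq_delta:
  assumes \<theta>: "\<And>i j. i < j \<Longrightarrow> j \<le> d \<Longrightarrow> \<theta> j < \<theta> i"
    and \<omega>: "\<And>j. j \<le> d \<Longrightarrow> cosine_sequence (\<theta> j) (\<omega> j)" and i: "i \<le> d"
  shows "(\<Sum>j\<le>d. inverse (cosine_norm (\<omega> j)) * \<omega> j i) = of_bool (i = 0)"
proof -
  define u where "u j i = \<omega> j i * sqrt (sphere_size i) / sqrt (cosine_norm (\<omega> j))" for j i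
  have pos: "0 < cosine_norm (\<omega> j)" if "j \<le> d" for j using cosine_norm_pos \<omega> that by blast
  have "(\<Sum>i\<le>d. u j i * u j' i) = of_bool (j = j')" if "j \<le> d" "j' \<le> d" for j j'
  proof -
    have "(\<Sum>i\<le>d. u j i * u j' i)
        = (\<Sum>i\<le>d. sphere_size i * (\<omega> j i * \<omega> j' i)) / (sqrt (cosine_norm (\<omega> j)) * sqrt (cosine_norm (\<omega> j')))"
      unfolding sum_divide_distrib
    proof (intro sum.cong refl)
      fix i
      have "u j i * u j' i = (sqrt (sphere_size i) * sqrt (sphere_size i)) * (\<omega> j i * \<omega> j' i)
          / (sqrt (cosine_norm (\<omega> j)) * sqrt (cosine_norm (\<omega> j')))"
        by (simp add: u_def)
      then show "u j i * u j' i = sphere_size i * (\<omega> j i * \<omega> j' i)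
          / (sqrt (cosine_norm (\<omega> j)) * sqrt (cosine_norm (\<omega> j')))"
        by (simp add: sphere_size_def)
    qed
    also have "\<dots> = of_bool (j = j')"
    proof (cases "j = j'")
      case True
      then show ?thesis using pos[OF \<open>j \<le> d\<close>] by (simp add: cosine_norm_def)
    next
      case False
      then have "\<theta> j \<noteq> \<theta> j'" using \<theta>[of j j'] \<theta>[of j' j] that by (cases "j < j'") auto
      then show ?thesis using cosines_orthogonal[OF \<omega> \<omega>] that False by simp
    qed
    finally show ?thesis .
  qed
  then have "(\<Sum>j\<le>d. u j i * u j 0) = of_bool (i = 0)"
    using orthonormal_rows_imp_columns[of d u i 0] i by simp
  moreover have "(\<Sum>j\<le>d. u j i * u j 0)
      = sqrt (sphere_size i) * (\<Sum>j\<le>d. inverse (cosine_norm (\<omega> j)) * \<omega> j i)"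
    unfolding sum_distrib_left
  proof (intro sum.cong refl)
    fix j assume "j \<in> {..d}"
    then have "\<omega> j 0 = 1" "0 < cosine_norm (\<omega> j)" using \<omega> pos by (auto simp: cosine_sequence_def)
    then show "u j i * u j 0 = sqrt (sphere_size i) * (inverse (cosine_norm (\<omega> j)) * \<omega> j i)"
      by (simp add: u_def sphere_size_0 field_simps)
  qed
  ultimately show ?thesis
    using sphere_size_pos[OF i] by (cases "i = 0") (auto simp: sphere_size_0)
qed

text \<open>
  The corresponding expansion of the adjacency matrix: \<open>P i 0\<close> is \<open>1\<close> for \<open>i = 1\<close> and \<open>0\<close> otherwise.
\<close>
lemma sum_eigenvalue_cosines:
  assumes \<theta>: "\<And>i j. i < j \<Longrightarrow> j \<le> d \<Longrightarrow> \<theta> j < \<theta> i"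
    and \<omega>: "\<And>j. j \<le> d \<Longrightarrow> cosine_sequence (\<theta> j) (\<omega> j)" and i: "i \<le> d"
  shows "(\<Sum>j\<le>d. inverse (cosine_norm (\<omega> j)) * (\<theta> j * \<omega> j i)) = P i 0"
proof -
  have "(\<Sum>j\<le>d. inverse (cosine_norm (\<omega> j)) * (\<theta> j * \<omega> j i))
      = (\<Sum>j\<le>d. \<Sum>h\<le>d. P i h * (inverse (cosine_norm (\<omega> j)) * \<omega> j h))"
  proof (intro sum.cong refl)
    fix j assume "j \<in> {..d}"
    then have eq: "\<theta> j * \<omega> j i = (\<Sum>h\<le>d. P i h * \<omega> j h)"
      using \<omega>[of j] i by (simp add: cosine_sequence_def)
    show "inverse (cosine_norm (\<omega> j)) * (\<theta> j * \<omega> j i)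
        = (\<Sum>h\<le>d. P i h * (inverse (cosine_norm (\<omega> j)) * \<omega> j h))"
      unfolding eq sum_distrib_left by (intro sum.cong refl) simp
  qed
  also have "\<dots> = (\<Sum>h\<le>d. P i h * (\<Sum>j\<le>d. inverse (cosine_norm (\<omega> j)) * \<omega> j h))"
    by (subst sum.swap) (simp add: sum_distrib_left)
  also have "\<dots> = (\<Sum>h\<le>d. of_bool (h = 0) * P i h)"
    using sum_cosines_eq_delta[OF \<theta> \<omega>] by (intro sum.cong refl) simp
  finally show ?thesis by (simp add: sum_of_bool_times)
qed

text \<open>
  The adjacency form vanishes at the difference \<open>v\<close> of the point masses at two points at distance two,
  while \<open>\<parallel>v\<parallel>\<^sup>2 = 2\<close> and \<open>v\<close> is orthogonal to the constants. If all eigenvalues other than \<open>k\<close> were at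
  most \<open>-1\<close>, the form would be at most \<open>-2\<close>. In the proof both forms are expanded in the cosine
  forms, and \<open>1 - \<omega> j 2\<close> is half the value of the \<open>j\<close>-th of these at \<open>v\<close>.
\<close>
lemma second_eigenvalue_gt:
  assumes \<theta>: "\<And>i j. i < j \<Longrightarrow> j \<le> d \<Longrightarrow> \<theta> j < \<theta> i"
    and \<omega>: "\<And>j. j \<le> d \<Longrightarrow> cosine_sequence (\<theta> j) (\<omega> j)" and "\<theta> 0 = k"
  shows "- 1 < \<theta> 1"
proof (rule ccontr)
  assume "\<not> ?thesis"
  define c where "c j = inverse (cosine_norm (\<omega> j))" for j
  \<comment> \<open>The term of the eigenvalue \<open>k\<close> drops out.\<close>
  have "\<omega> 0 1 = 1" using cosine_1[OF \<omega>[of 0]] \<open>\<theta> 0 = k\<close> k_pos by simp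
  then have \<omega>02: "\<omega> 0 2 = 1" using cosine_differences(2)[OF \<omega>[of 0]] b_pos by simp
  have "c j * ((1 + \<theta> j) * (1 - \<omega> j 2)) \<le> 0" if j: "j \<le> d" for j
  proof (cases "j = 0")
    case True then show ?thesis using \<omega>02 by simp
  next
    case False
    then have "\<theta> j \<le> \<theta> 1" using \<theta>[of 1 j] j by (cases "j = 1") auto
    then have "1 + \<theta> j \<le> 0" using \<open>\<not> - 1 < \<theta> 1\<close> by simp
    moreover have "0 \<le> 1 - \<omega> j 2" using abs_cosine_le_1[OF \<omega>[OF j], of 2] three_le_d by simp
    moreover have "0 < c j" using cosine_norm_pos[OF \<omega>[OF j]] by (simp add: c_def)
    ultimately show ?thesis by (simp add: mult_nonneg_nonpos mult_nonpos_nonneg)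
  qed
  then have "(\<Sum>j\<le>d. c j * ((1 + \<theta> j) * (1 - \<omega> j 2))) \<le> 0" by (intro sum_nonpos) auto
  also have "(\<Sum>j\<le>d. c j * ((1 + \<theta> j) * (1 - \<omega> j 2)))
      = (\<Sum>j\<le>d. c j * \<omega> j 0) - (\<Sum>j\<le>d. c j * \<omega> j 2)
        + ((\<Sum>j\<le>d. c j * (\<theta> j * \<omega> j 0)) - (\<Sum>j\<le>d. c j * (\<theta> j * \<omega> j 2)))"
    unfolding sum_subtractf[symmetric] sum.distrib[symmetric]
    using \<omega> by (intro sum.cong refl) (simp add: cosine_sequence_def algebra_simps)
  also have "\<dots> = 1"
    using three_le_d by (simp add: c_def sum_cosines_eq_delta[OF \<theta> \<omega>] sum_eigenvalue_cosines[OF \<theta> \<omega>] P_eq_0 P_0)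
  finally show False by simp
qed

text \<open>
  On a path \<open>x, y, z\<close> with \<open>x\<close> and \<open>z\<close> at distance two, the vector \<open>(1, -1, 1)\<close> has squared norm \<open>3\<close>
  and the adjacency form takes the value \<open>-4\<close> at it. This is impossible if all eigenvalues are at
  least \<open>-1\<close>.
\<close>
lemma least_eigenvalue_less:
  assumes \<theta>: "\<And>i j. i < j \<Longrightarrow> j \<le> d \<Longrightarrow> \<theta> j < \<theta> i"
    and \<omega>: "\<And>j. j \<le> d \<Longrightarrow> cosine_sequence (\<theta> j) (\<omega> j)"
  shows "\<theta> d < - 1"
proof (rule ccontr)
  assume "\<not> ?thesis"
  define c where "c j = inverse (cosine_norm (\<omega> j))" for j
  obtain x z where xz: "x \<in> V" "z \<in> V" "D x z = 2" using exists_pair[of 2] three_le_d by auto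
  then obtain y where y: "y \<in> V" "D x y = 1" "D y z = 1" using D_geodesic[of x z 1] by auto
  have ne: "x \<noteq> y" "y \<noteq> z" "x \<noteq> z" using xz y by (auto simp: D_self)
  have "0 \<le> c j * ((1 + \<theta> j) * (3 - 4 * \<omega> j 1 + 2 * \<omega> j 2))" if j: "j \<le> d" for j
  proof -
    have "\<theta> d \<le> \<theta> j" using \<theta>[of j d] j by (cases "j = d") auto
    then have "0 \<le> 1 + \<theta> j" using \<open>\<not> \<theta> d < - 1\<close> by simp
    moreover have "0 \<le> 3 - 4 * \<omega> j 1 + 2 * \<omega> j 2"
      using cosine_form_nonneg[OF \<omega>[OF j], of "{x,y,z}" "\<lambda>u. if u = y then -1 else 1"]
        xz y ne D_sym[of y x] D_sym[of z y] D_sym[of z x] \<omega>[OF j]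
      by (simp add: D_self cosine_sequence_def)
    moreover have "0 < c j" using cosine_norm_pos[OF \<omega>[OF j]] by (simp add: c_def)
    ultimately show ?thesis by simp
  qed
  then have "0 \<le> (\<Sum>j\<le>d. c j * ((1 + \<theta> j) * (3 - 4 * \<omega> j 1 + 2 * \<omega> j 2)))"
    by (intro sum_nonneg) auto
  also have "\<dots> = 3 * (\<Sum>j\<le>d. c j * \<omega> j 0) - 4 * (\<Sum>j\<le>d. c j * \<omega> j 1) + 2 * (\<Sum>j\<le>d. c j * \<omega> j 2)
      + (3 * (\<Sum>j\<le>d. c j * (\<theta> j * \<omega> j 0)) - 4 * (\<Sum>j\<le>d. c j * (\<theta> j * \<omega> j 1))
         + 2 * (\<Sum>j\<le>d. c j * (\<theta> j * \<omega> j 2)))"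
    unfolding sum_distrib_left sum_subtractf[symmetric] sum.distrib[symmetric]
    using \<omega> by (intro sum.cong refl) (simp add: cosine_sequence_def algebra_simps)
  also have "\<dots> = - 1"
    using three_le_d P_1_0
    by (simp add: c_def sum_cosines_eq_delta[OF \<theta> \<omega>] sum_eigenvalue_cosines[OF \<theta> \<omega>] P_eq_0 P_0)
  finally show False by simp
qed

text \<open>
  Two points of the neighbourhood \<open>N\<close> of \<open>x\<close> have distance at most two, so for a function \<open>v\<close> on \<open>N\<close> with
  sum zero the cosine form is \<open>(1 - \<omega> 2) \<parallel>v\<parallel>\<^sup>2 + (\<omega> 1 - \<omega> 2) \<langle>v, A v\<rangle>\<close>. By the first two rows of the
  recurrence, \<open>b\<close> times the coefficients is \<open>1 - \<omega> 1\<close> times those of the claim, and \<open>\<omega> 1 < 1\<close> because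
  \<open>\<theta> < k\<close>.
\<close>
subsection \<open>Functions on a neighbourhood\<close>

lemma local_form_bound:
  assumes \<omega>: "cosine_sequence \<theta> \<omega>" and "\<theta> < k" and x: "x \<in> V"
  defines "N \<equiv> {y \<in> V. D x y = 1}"
  assumes "(\<Sum>y\<in>N. v y) = 0"
  shows "0 \<le> (b + 1 + \<theta>) * (\<Sum>y\<in>N. v y * v y)
    + (1 + \<theta>) * (\<Sum>y\<in>N. v y * adj_op N (\<lambda>y z. D y z = 1) v y)"
proof -
  define Q where "Q = (\<Sum>y\<in>N. v y * v y)"
  define R where "R = (\<Sum>y\<in>N. v y * adj_op N (\<lambda>y z. D y z = 1) v y)"
  have fin: "finite N" using finite_V by (simp add: N_def)
  have entry: "\<omega> (D y z) = \<omega> 2 + (1 - \<omega> 2) * of_bool (z = y) + (\<omega> 1 - \<omega> 2) * of_bool (D y z = 1)"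
    if "y \<in> N" "z \<in> N" for y z
  proof -
    have "y \<in> V" "z \<in> V" "D y z \<le> 2"
      using that x D_triangle[of y x z] D_sym[of y x] by (auto simp: N_def)
    then consider "D y z = 0" | "D y z = 1" | "D y z = 2" by linarith
    then show ?thesis
      using \<omega> \<open>y \<in> V\<close> \<open>z \<in> V\<close> D_eq_0_iff[of y z]
      by cases (auto simp: cosine_sequence_def D_self)
  qed
  have "(\<Sum>y\<in>N. \<Sum>z\<in>N. \<omega> (D y z) * (v y * v z))
      = (\<Sum>y\<in>N. \<Sum>z\<in>N. \<omega> 2 * v y * v z + (1 - \<omega> 2) * v y * (of_bool (z = y) * v z)
          + (\<omega> 1 - \<omega> 2) * v y * (of_bool (D y z = 1) * v z))"
    by (intro sum.cong refl) (simp only: entry, simp only: algebra_simps)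
  also have "\<dots> = (\<Sum>y\<in>N. \<omega> 2 * v y * (\<Sum>z\<in>N. v z) + (1 - \<omega> 2) * (v y * v y)
          + (\<omega> 1 - \<omega> 2) * (v y * adj_op N (\<lambda>y z. D y z = 1) v y))"
    by (intro sum.cong refl)
      (simp add: sum.distrib adj_op_eq_sum[OF fin] sum_of_bool_times[OF fin] flip: sum_distrib_left)
  also have "\<dots> = (1 - \<omega> 2) * Q + (\<omega> 1 - \<omega> 2) * R"
    using assms(5) by (simp add: sum.distrib Q_def R_def sum_distrib_left)
  finally have "0 \<le> (1 - \<omega> 2) * Q + (\<omega> 1 - \<omega> 2) * R"
    using cosine_form_nonneg[OF \<omega>, of N v] by (simp add: N_def)
  then have "0 \<le> b * ((1 - \<omega> 2) * Q + (\<omega> 1 - \<omega> 2) * R)"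
    using b_pos by simp
  also have "\<dots> = (b * (1 - \<omega> 2)) * Q + (b * (\<omega> 1 - \<omega> 2)) * R"
    by (simp add: algebra_simps)
  also have "\<dots> = (1 - \<omega> 1) * ((b + 1 + \<theta>) * Q + (1 + \<theta>) * R)"
    unfolding cosine_differences[OF \<omega>] by (simp add: algebra_simps)
  finally have "0 \<le> (1 - \<omega> 1) * ((b + 1 + \<theta>) * Q + (1 + \<theta>) * R)" .
  moreover have "0 < 1 - \<omega> 1"
    using cosine_1[OF \<omega>] \<open>\<theta> < k\<close> k_pos by (metis diff_gt_0_iff_gt mult.right_neutral mult_less_cancel_left_pos)
  ultimately show ?thesis by (simp add: zero_le_mult_iff Q_def R_def)
qed

lemma local_regular:
  assumes "x \<in> V" shows "regular_graph_on {y \<in> V. D x y = 1} (\<lambda>y z. D y z = 1) a"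
proof
  fix y assume y: "y \<in> {y \<in> V. D x y = 1}"
  then have "{z \<in> {y \<in> V. D x y = 1}. D y z = 1} = {z \<in> V. D x z = 1 \<and> D y z = 1}" by auto
  then show "real (card {z \<in> {y \<in> V. D x y = 1}. D y z = 1}) = a"
    using P_eq_card[of x y 1] y assms three_le_d by simp
qed (use finite_V in \<open>auto simp: D_sym D_self\<close>)

end

section \<open>Path-length distance of distance-regular graphs\<close>

lemma (in graph) connected_iff:
  "Digraph_Component.connected G \<longleftrightarrow> verts G \<noteq> {} \<and> (\<forall>u\<in>verts G. \<forall>v\<in>verts G. u \<rightarrow>\<^sup>*\<^bsub>G\<^esub> v)"
  unfolding Digraph_Component.connected_def strongly_connected_def
  by (simp add: reachable_mk_symmetric_eq[OF sym_arcs])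

text \<open>
  Walks of length \<open>n\<close> become steps in the \<open>n\<close>-th relational power, for which concatenation, splitting
  off the last step and reversal are available.
\<close>
lemma (in wf_digraph) awalk_of_length_iff:
  "(\<exists>p. awalk u p v \<and> length p = n) \<longleftrightarrow> u \<in> verts G \<and> (u, v) \<in> arcs_ends G ^^ n"
proof (induction n arbitrary: u)
  case 0
  then show ?case by (auto simp: awalk_Nil_iff)
next
  case (Suc n)
  show ?case
  proof
    assume "\<exists>p. awalk u p v \<and> length p = Suc n"
    then obtain e p where ep: "awalk u (e # p) v" "length p = n" by (metis length_Suc_conv)
    then have "e \<in> arcs G" "tail G e = u" "awalk (head G e) p v" by (auto simp: awalk_Cons_iff)
    then have "(u, head G e) \<in> arcs_ends G" "(head G e, v) \<in> arcs_ends G ^^ n"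
      using Suc.IH ep(2) by (auto simp: arcs_ends_conv)
    then show "u \<in> verts G \<and> (u, v) \<in> arcs_ends G ^^ Suc n"
      using adj_in_verts relpow_Suc_I2 by metis
  next
    assume "u \<in> verts G \<and> (u, v) \<in> arcs_ends G ^^ Suc n"
    then obtain w where w: "(u, w) \<in> arcs_ends G" "(w, v) \<in> arcs_ends G ^^ n"
      by (meson relpow_Suc_D2)
    then obtain p where p: "awalk w p v" "length p = n" using Suc.IH adj_in_verts by blast
    obtain e where "e \<in> arcs G" "tail G e = u" "head G e = w" using w(1) by auto
    then have "awalk u (e # p) v" using p by (simp add: awalk_Cons_iff)
    then show "\<exists>p. awalk u p v \<and> length p = Suc n" using p(2) by (metis length_Cons)
  qed
qed

locale connected_graph = graph G for G :: "('a, 'b) pre_digraph" +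
  assumes conn: "Digraph_Component.connected G"
begin

lemma graph_dist_eq_Least:
  "u \<in> verts G \<Longrightarrow> graph_dist G u v = (LEAST n. (u, v) \<in> arcs_ends G ^^ n)"
  unfolding graph_dist_def awalk_of_length_iff by simp

lemma graph_dist_le: "u \<in> verts G \<Longrightarrow> (u, v) \<in> arcs_ends G ^^ n \<Longrightarrow> graph_dist G u v \<le> n"
  by (simp add: graph_dist_eq_Least Least_le)

lemma relpow_graph_dist:
  assumes "u \<in> verts G" "v \<in> verts G" shows "(u, v) \<in> arcs_ends G ^^ graph_dist G u v"
proof -
  have "(u, v) \<in> (arcs_ends G)\<^sup>*"
    using assms conn by (auto simp: connected_iff intro: reachable_rtranclI)
  then obtain n where "(u, v) \<in> arcs_ends G ^^ n" by (meson rtrancl_imp_relpow)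
  then show ?thesis unfolding graph_dist_eq_Least[OF assms(1)] by (rule LeastI)
qed

lemma dominates_iff_graph_dist:
  assumes "x \<in> verts G" "y \<in> verts G" shows "x \<rightarrow>\<^bsub>G\<^esub> y \<longleftrightarrow> graph_dist G x y = 1"
proof
  assume xy: "x \<rightarrow>\<^bsub>G\<^esub> y"
  then have "graph_dist G x y \<le> 1" using graph_dist_le[of x y 1] assms by simp
  moreover have "graph_dist G x y \<noteq> 0"
  proof
    assume "graph_dist G x y = 0"
    then have "x = y" using relpow_graph_dist[OF assms] by simp
    then show False using xy adj_not_same by blast
  qed
  ultimately show "graph_dist G x y = 1" by simp
next
  assume "graph_dist G x y = 1"
  then show "x \<rightarrow>\<^bsub>G\<^esub> y" using relpow_graph_dist[OF assms] by simp
qed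

end

lemma distance_regular_metric_of_graph:
  assumes "distance_regular G" and "3 \<le> diameter G"
  shows "distance_regular_metric (verts G) (graph_dist G) (diameter G) (intersection_number G)"
proof -
  interpret graph G using assms(1) by (simp add: distance_regular_def)
  interpret connected_graph G using assms(1) by unfold_locales (simp add: distance_regular_def)
  define \<Delta> where "\<Delta> = {graph_dist G x y | x y. x \<in> verts G \<and> y \<in> verts G}"
  have \<Delta>: "diameter G = Max \<Delta>" by (simp add: \<Delta>_def diameter_def)
  have "\<Delta> = (\<lambda>(x, y). graph_dist G x y) ` (verts G \<times> verts G)" by (auto simp: \<Delta>_def)
  then have fin: "finite \<Delta>" and ne: "\<Delta> \<noteq> {}" using conn by (auto simp: connected_iff)
  have flip: "(v, u) \<in> arcs_ends G ^^ n" if "(u, v) \<in> arcs_ends G ^^ n" for u v n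
    using that
  proof (induction n arbitrary: v)
    case (Suc n)
    then obtain w where w: "(u, w) \<in> arcs_ends G ^^ n" "(w, v) \<in> arcs_ends G" by auto
    then have "(v, w) \<in> arcs_ends G" using arcs_ends_symmetric[OF sym_arcs] by blast
    then show ?case using Suc.IH[OF w(1)] by (rule relpow_Suc_I2)
  qed simp
  show ?thesis
  proof
    show "finite (verts G)" by simp
    show "graph_dist G x y = 0 \<longleftrightarrow> x = y" if "x \<in> verts G" "y \<in> verts G" for x y
      using relpow_graph_dist[OF that] graph_dist_le[of x y 0] that by auto
    show "graph_dist G x y = graph_dist G y x" if "x \<in> verts G" "y \<in> verts G" for x y
      using graph_dist_le[OF that(1) flip] graph_dist_le[OF that(2) flip] relpow_graph_dist that
      by (meson antisym)
    show "graph_dist G x z \<le> graph_dist G x y + graph_dist G y z"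
      if "x \<in> verts G" "y \<in> verts G" "z \<in> verts G" for x y z
    proof (rule graph_dist_le)
      show "(x, z) \<in> arcs_ends G ^^ (graph_dist G x y + graph_dist G y z)"
        unfolding relpow_add by (rule relcompI) (rule relpow_graph_dist; fact)+
    qed (fact that)
    show "graph_dist G x y \<le> diameter G" if "x \<in> verts G" "y \<in> verts G" for x y
      unfolding \<Delta> using that by (intro Max_ge fin) (auto simp: \<Delta>_def)
    show "\<exists>y\<in>verts G. graph_dist G x y = i \<and> graph_dist G y z = 1"
      if x: "x \<in> verts G" and z: "z \<in> verts G" and i: "graph_dist G x z = Suc i" for x z i
    proof -
      obtain y where y: "(x, y) \<in> arcs_ends G ^^ i" "y \<rightarrow>\<^bsub>G\<^esub> z"
        using relpow_graph_dist[OF x z] i by auto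
      have yV: "y \<in> verts G" using adj_in_verts y(2) by blast
      have "(x, z) \<in> arcs_ends G ^^ Suc (graph_dist G x y)"
        using relpow_graph_dist[OF x yV] y(2) by auto
      then have "i \<le> graph_dist G x y" using graph_dist_le[OF x] i by fastforce
      then show ?thesis
        using graph_dist_le[OF x y(1)] y(2) yV z dominates_iff_graph_dist by (intro bexI[of _ y]) auto
    qed
    show "\<exists>x\<in>verts G. \<exists>y\<in>verts G. graph_dist G x y = diameter G"
    proof -
      have "diameter G \<in> \<Delta>" unfolding \<Delta> by (rule Max_in[OF fin ne])
      then obtain x y where "diameter G = graph_dist G x y" "x \<in> verts G" "y \<in> verts G"
        unfolding \<Delta>_def by blast
      then show ?thesis by metis
    qed
    show "3 \<le> diameter G" by (rule assms(2))
    show "card {w \<in> verts G. graph_dist G x w = i \<and> graph_dist G y w = j}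
        = intersection_number G (graph_dist G x y) i j"
      if xy: "x \<in> verts G" "y \<in> verts G" and ij: "i \<le> diameter G" "j \<le> diameter G" for x y i j
    proof -
      have "graph_dist G x y \<le> diameter G"
        unfolding \<Delta> using xy by (intro Max_ge fin) (auto simp: \<Delta>_def)
      then obtain q where q: "\<forall>u \<in> verts G. \<forall>v \<in> verts G. graph_dist G u v = graph_dist G x y \<longrightarrow>
          card (sphere G i u \<inter> sphere G j v) = q"
        using assms(1) ij unfolding distance_regular_def by meson
      then have "intersection_number G (graph_dist G x y) i j = q"
        unfolding intersection_number_def using xy by (intro the_equality) auto
      moreover have "{w \<in> verts G. graph_dist G x w = i \<and> graph_dist G y w = j} = sphere G i x \<inter> sphere G j y"
        by (auto simp: sphere_def)
      ultimately show ?thesis using q xy by simp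
    qed
  qed
qed

section \<open>Connected strongly-regular graphs and their eigenvalues\<close>

text \<open>
  The tightness equation and \<open>r < s < a\<close> make \<open>a + r s\<close> positive. This is the number of common
  neighbours of two nonadjacent vertices, so the graph is connected. An eigenfunction for an eigenvalue
  other than \<open>a\<close> has sum zero, so that eigenvalue is a root of \<open>(t - r) (t - s)\<close>; conversely every
  edge yields eigenfunctions for both roots.
\<close>
lemma connected_srg_of_common:
  assumes H: "graph H" and reg: "regular_graph_on (verts H) (dominates H) a" and ne: "verts H \<noteq> {}"
    and rs: "r < s" "s < a" "r \<noteq> -1" "s \<noteq> - 1" and a: "0 < a"
    and tight: "real (card (verts H)) * (a + r * s) = (a - r) * (a - s)"
    and c: "\<And>y z. y \<in> verts H \<Longrightarrow> z \<in> verts H \<Longrightarrow> regular_graph_on.common (verts H) (dominates H) y z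
      = (r + s) * of_bool (y \<rightarrow>\<^bsub>H\<^esub> z) - r * s * of_bool (y = z) + (a + r * s)"
  shows "connected_srg_with_eigenvalues H a s r"
proof -
  interpret graph H by (rule H)
  interpret regular_graph_on "verts H" "dominates H" a by (rule reg)
  have "0 < a + r * s"
  proof -
    have "0 < real (card (verts H)) * (a + r * s)" unfolding tight using rs by simp
    then show ?thesis by (simp add: zero_less_mult_iff)
  qed
  have card_nbrs: "real (card (neighbours H y)) = a" if "y \<in> verts H" for y
    using regular[OF that] by (simp add: neighbours_def)
  have card_common: "real (card (neighbours H y \<inter> neighbours H z)) = common y z" for y z
    unfolding common_def neighbours_def by (rule arg_cong[of _ _ "\<lambda>A. real (card A)"]) auto
  have "y \<rightarrow>\<^sup>*\<^bsub>H\<^esub> z" if yz: "y \<in> verts H" "z \<in> verts H" for y z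
  proof (cases "y = z \<or> y \<rightarrow>\<^bsub>H\<^esub> z")
    case True
    then show ?thesis using yz by auto
  next
    case False
    then have "0 < real (card (neighbours H y \<inter> neighbours H z))"
      using c[OF yz] \<open>0 < a + r * s\<close> by (simp only: card_common) simp
    then have "neighbours H y \<inter> neighbours H z \<noteq> {}" by (metis card.empty less_irrefl of_nat_0)
    then obtain w where "w \<in> neighbours H y \<inter> neighbours H z" by blast
    then have "y \<rightarrow>\<^bsub>H\<^esub> w" "w \<rightarrow>\<^bsub>H\<^esub> z" using sym yz by (auto simp: neighbours_def)
    then show ?thesis by (meson adj_reachable_trans reachable_adjI)
  qed
  then have conn: "Digraph_Component.connected H" using ne by (simp add: connected_iff)
  \<comment> \<open>The counts are known as reals that do not depend on the vertices.\<close>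
  have to_nat: "n = nat \<lfloor>t\<rfloor>" if "real n = t" for n t using that by auto
  have "strongly_regular H (card (verts H)) (nat \<lfloor>a\<rfloor>) (nat \<lfloor>r + s + (a + r * s)\<rfloor>) (nat \<lfloor>a + r * s\<rfloor>)"
    unfolding strongly_regular_def
  proof (intro conjI ballI impI H refl)
    fix y assume "y \<in> verts H"
    then show "card (neighbours H y) = nat \<lfloor>a\<rfloor>" by (intro to_nat card_nbrs)
  next
    fix y z assume "y \<in> verts H" "z \<in> verts H" "y \<rightarrow>\<^bsub>H\<^esub> z"
    then show "card (neighbours H y \<inter> neighbours H z) = nat \<lfloor>r + s + (a + r * s)\<rfloor>"
      using irrefl by (intro to_nat) (auto simp: card_common c)
  next
    fix y z assume "y \<in> verts H" "z \<in> verts H" "y \<noteq> z \<and> \<not> y \<rightarrow>\<^bsub>H\<^esub> z"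
    then show "card (neighbours H y \<inter> neighbours H z) = nat \<lfloor>a + r * s\<rfloor>"
      by (intro to_nat) (simp add: card_common c)
  qed
  moreover have "graph_eigenvalues H = {a, s, r}"
  proof (intro equalityI subsetI)
    fix t assume "t \<in> graph_eigenvalues H"
    then obtain f y where y: "y \<in> verts H" "f y \<noteq> 0"
      and f: "\<And>y. y \<in> verts H \<Longrightarrow> A f y = t * f y"
      by (auto simp: graph_eigenvalues_iff[OF finite_verts])
    have "t = s \<or> t = r" if "t \<noteq> a"
    proof -
      have "A (A f) y = A (\<lambda>z. t * f z) y"
        unfolding adj_op_def[of _ _ _ y] by (intro sum.cong refl) (simp add: f)
      then have "t * (t * f y) = A (A f) y" using y f by (simp add: A_scale)
      also have "\<dots> = (r + s) * (t * f y) - r * s * f y"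
        using A_A_eq[OF y(1), of "r + s" "- (r * s)" "a + r * s" f] c[OF y(1)]
          sum_eigenfunction_eq_0[OF f that] f[OF y(1)] by simp
      finally have "f y * ((t - s) * (t - r)) = 0" by (simp add: algebra_simps)
      then show ?thesis using y by simp
    qed
    then show "t \<in> {a, s, r}" by auto
  next
    fix t assume t: "t \<in> {a, s, r}"
    obtain y where y: "y \<in> verts H" using ne by blast
    then have "card {z \<in> verts H. y \<rightarrow>\<^bsub>H\<^esub> z} > 0" using regular[OF y] a by (simp flip: of_nat_0_less_iff)
    then obtain z where z: "z \<in> verts H" "y \<rightarrow>\<^bsub>H\<^esub> z" by (auto simp: card_gt_0_iff)
    have "\<exists>f. f y \<noteq> 0 \<and> (\<forall>x\<in>verts H. A f x = t * f x)"
    proof -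
      consider "t = a" | "t = s" | "t = r" using t by blast
      then show ?thesis
      proof cases
        case 1
        then show ?thesis by (intro exI[of _ "\<lambda>_. 1"]) (simp add: A_const)
      next
        case 2
        then show ?thesis using eigenvalue_of_quadratic[OF c y z \<open>r \<noteq> -1\<close>] by metis
      next
        case 3
        have "common y z = (s + r) * of_bool (y \<rightarrow>\<^bsub>H\<^esub> z) - s * r * of_bool (y = z) + (a + r * s)"
          if "y \<in> verts H" "z \<in> verts H" for y z using c[OF that] by (simp add: mult_ac add_ac)
        from eigenvalue_of_quadratic[OF this y z \<open>s \<noteq> -1\<close>] 3 show ?thesis by metis
      qed
    qed
    then show "t \<in> graph_eigenvalues H"
      unfolding graph_eigenvalues_iff[OF finite_verts] using y by blast
  qed
  moreover have "distinct [a, s, r]" using rs by simp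
  ultimately show ?thesis using conn unfolding connected_srg_with_eigenvalues_def by blast
qed

text \<open>
  With the parameters \<open>l\<close> and \<open>m\<close> of the strongly-regular graph,
  \<open>A\<^sup>2 = (l - m) A + (a - m) I + m J\<close>. Eigenfunctions for \<open>r\<close> and \<open>s\<close> have sum zero, so \<open>r\<close> and \<open>s\<close> are
  the two roots of \<open>t\<^sup>2 = (l - m) t + (a - m)\<close>. Hence \<open>l - m = r + s\<close> and \<open>m = a + r s\<close>, and the
  identity applied to the constant function is the claim. If \<open>a\<close> were \<open>0\<close>, there would be no edges and
  \<open>0\<close> would be the only eigenvalue.
\<close>
lemma connected_srg_imp_tight_equation:
  assumes reg: "regular_graph_on (verts H) (dominates H) a" and ne: "verts H \<noteq> {}"
    and srg: "connected_srg_with_eigenvalues H a s r"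
  shows "real (card (verts H)) * (a + r * s) = (a - r) * (a - s)" and "a \<noteq> 0"
proof -
  interpret regular_graph_on "verts H" "dominates H" a by (rule reg)
  obtain \<nu> \<kappa> l m where sr: "strongly_regular H \<nu> \<kappa> l m"
    and dist: "a \<noteq> s" "a \<noteq> r" "s \<noteq> r" and ev: "graph_eigenvalues H = {a, s, r}"
    using srg by (auto simp: connected_srg_with_eigenvalues_def)
  obtain y where y: "y \<in> verts H" using ne by blast
  have card_common: "real (card (neighbours H y \<inter> neighbours H z)) = common y z" for y z
    unfolding common_def neighbours_def by (rule arg_cong[of _ _ "\<lambda>A. real (card A)"]) auto
  have c: "common y z = (real l - real m) * of_bool (y \<rightarrow>\<^bsub>H\<^esub> z) + (a - real m) * of_bool (y = z) + real m"
    if yz: "y \<in> verts H" "z \<in> verts H" for y z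
    using sr yz irrefl[OF yz(1)] common_self[OF yz(1)] unfolding strongly_regular_def
    by (cases "y = z"; cases "y \<rightarrow>\<^bsub>H\<^esub> z") (auto simp flip: card_common)
  have root: "t * t = (real l - real m) * t + (a - real m)" if "t \<in> {s, r}" for t
  proof -
    have "t \<in> graph_eigenvalues H" "t \<noteq> a" using that ev dist by auto
    then obtain f y where y: "y \<in> verts H" "f y \<noteq> 0"
      and f: "\<And>y. y \<in> verts H \<Longrightarrow> A f y = t * f y"
      by (auto simp: graph_eigenvalues_iff[OF finite_S])
    have "A (A f) y = A (\<lambda>z. t * f z) y"
      unfolding adj_op_def[of _ _ _ y] by (intro sum.cong refl) (simp add: f)
    then have "t * (t * f y) = A (A f) y" using y f by (simp add: A_scale)
    also have "\<dots> = (real l - real m) * (t * f y) + (a - real m) * f y"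
      using A_A_eq[OF y(1) c[OF y(1)], of f] sum_eigenfunction_eq_0[OF f \<open>t \<noteq> a\<close>] f[OF y(1)] by simp
    finally have "f y * (t * t) = f y * ((real l - real m) * t + (a - real m))"
      by (simp add: algebra_simps)
    then show ?thesis using y by simp
  qed
  have "(s - r) * (s + r - (real l - real m)) = 0"
    using root[of s] root[of r] by (simp add: algebra_simps)
  then have sum: "real l - real m = s + r" using dist by simp
  then have prod: "real m = a + r * s" using root[of s] by (simp add: algebra_simps)
  have count: "a * a = (real l - real m) * a + (a - real m) + real m * real (card (verts H))"
  proof -
    have "A (A (\<lambda>_. 1)) y = A (\<lambda>_. a) y"
      unfolding adj_op_def[of _ _ _ y] by (intro sum.cong refl) (simp add: A_const)
    then show ?thesis using A_A_eq[OF y c[OF y], of "\<lambda>_. 1"] y by (simp add: A_const)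
  qed
  show "real (card (verts H)) * (a + r * s) = (a - r) * (a - s)"
    using count[unfolded sum, unfolded prod] by (simp add: algebra_simps)
  show "a \<noteq> 0"
  proof
    assume "a = 0"
    have "t = 0" if "t \<in> graph_eigenvalues H" for t
    proof -
      obtain f y where y: "y \<in> verts H" "f y \<noteq> 0" "A f y = t * f y"
        using \<open>t \<in> graph_eigenvalues H\<close> by (auto simp: graph_eigenvalues_iff[OF finite_S])
      have "{z \<in> verts H. y \<rightarrow>\<^bsub>H\<^esub> z} = {}"
        using regular[OF y(1)] \<open>a = 0\<close> finite_S by simp
      then have "A f y = 0" by (simp only: adj_op_def sum.empty)
      then show ?thesis using y by simp
    qed
    then show False using ev dist by auto
  qed
qed

section \<open>Local graphs of tight distance-regular graphs\<close>

text \<open>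
  The definition of tightness quantifies over the enumeration of the eigenvalues; this makes it
  refer to a given one.
\<close>
lemma ordered_eigenvalues_unique:
  assumes "ordered_eigenvalues G \<theta>" "ordered_eigenvalues G \<theta>'" "i \<le> diameter G"
  shows "\<theta> i = \<theta>' i"
  using assms(3)
proof (induction i rule: less_induct)
  case (less i)
  have le: "f i \<le> g i"
    if "ordered_eigenvalues G f" "ordered_eigenvalues G g" "\<And>j. j < i \<Longrightarrow> f j = g j" for f g
  proof -
    have "f i \<in> g ` {0..diameter G}" using that(1,2) less.prems by (auto simp: ordered_eigenvalues_def)
    then obtain j where j: "j \<le> diameter G" "f i = g j" by auto
    have "\<not> j < i" using that j less.prems by (metis less_irrefl ordered_eigenvalues_def)
    then show ?thesis using that(2) j less.prems
      by (cases "i = j") (auto simp: ordered_eigenvalues_def less_imp_le)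
  qed
  show ?case using le[OF assms(1,2)] le[OF assms(2,1)] less by (intro antisym) auto
qed

lemma dominates_induce_iff: "y \<rightarrow>\<^bsub>G \<restriction> S\<^esub> z \<longleftrightarrow> y \<in> S \<and> z \<in> S \<and> y \<rightarrow>\<^bsub>G\<^esub> z"
  by (auto simp: arcs_ends_conv induce_subgraph_def)

lemma graph_induce:
  assumes "graph G" "S \<subseteq> verts G" shows "graph (G \<restriction> S)"
proof -
  interpret graph G by (rule assms(1))
  have ind: "induced_subgraph (G \<restriction> S) G" by (rule induced_induce[OF assms(2)])
  interpret H: digraph "G \<restriction> S" by (rule digraphI_induced[OF ind])
  show ?thesis using induced_graph_imp_symmetric[OF sym_arcs ind] by (rule H.graphI)
qed

text \<open>
  With \<open>u = 1 + \<theta>\<^sub>1\<close> and \<open>v = 1 + \<theta>\<^sub>d\<close>, both equations say that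
  \<open>W = (a + 1) u v + b (u + v) + (a + b) b\<close> vanishes.
\<close>
lemma tight_equation_iff:
  fixes a b u v :: real
  assumes "0 \<le> a" "u \<noteq> 0" "v \<noteq> 0" "b \<noteq> 0"
  defines "k \<equiv> 1 + a + b" and "r \<equiv> - 1 - b / u" and "s \<equiv> - 1 - b / v"
  shows "(u - 1 + k / (a + 1)) * (v - 1 + k / (a + 1)) = - (k * a * b) / (a + 1)\<^sup>2
    \<longleftrightarrow> k * (a + r * s) = (a - r) * (a - s)"
proof -
  define W where "W = (a + 1) * (u * v) + b * (u + v) + (a + b) * b"
  have clear: "c\<^sup>2 * (x * y + z / c\<^sup>2) = (c * x) * (c * y) + z" if "c \<noteq> 0" for c x y z :: real
    using that by (simp add: power2_eq_square field_simps)
  have k: "(a + 1) * (x - 1 + k / (a + 1)) = (a + 1) * x + b" for x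
    using assms(1) by (simp add: k_def field_simps)
  have "(a + 1)\<^sup>2 * ((u - 1 + k / (a + 1)) * (v - 1 + k / (a + 1)) + (k * a * b) / (a + 1)\<^sup>2)
      = ((a + 1) * u + b) * ((a + 1) * v + b) + k * a * b"
    using assms(1) by (subst clear) (simp_all add: k)
  also have "\<dots> = (a + 1) * W" by (simp add: W_def k_def algebra_simps)
  finally have 1: "(a + 1)\<^sup>2 * ((u - 1 + k / (a + 1)) * (v - 1 + k / (a + 1)) + (k * a * b) / (a + 1)\<^sup>2)
      = (a + 1) * W" .
  have "u * v * (k * (a + r * s) - (a - r) * (a - s))
      = k * (a * (u * v) + (u + b) * (v + b)) - ((a + 1) * u + b) * ((a + 1) * v + b)"
    using assms(2,3) by (simp add: r_def s_def field_simps)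
  also have "\<dots> = b * W" by (simp add: W_def k_def algebra_simps)
  finally have 2: "u * v * (k * (a + r * s) - (a - r) * (a - s)) = b * W" .
  have "(u - 1 + k / (a + 1)) * (v - 1 + k / (a + 1)) = - (k * a * b) / (a + 1)\<^sup>2
    \<longleftrightarrow> W = 0"
    using 1 assms(1) by (auto simp: add_eq_0_iff2)
  also have "\<dots> \<longleftrightarrow> k * (a + r * s) = (a - r) * (a - s)"
    using 2 assms(2-4) by auto
  finally show ?thesis .
qed

theorem theorem12p6:
  fixes G :: "('a, 'b) pre_digraph" and \<theta> :: "nat \<Rightarrow> real"
    and a1 b1 b_minus b_plus :: real
  assumes "distance_regular G"
    and "diameter G \<ge> 3"
    and "ordered_eigenvalues G \<theta>"
    and "a1 = real (int_a G 1)"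
    and "b1 = real (int_b G 1)"
    and "b_minus = - 1 - b1 / (1 + \<theta> 1)"
    and "b_plus = - 1 - b1 / (1 + \<theta> (diameter G))"
  shows "(tight G \<longleftrightarrow>
      (\<forall>x \<in> verts G. connected_srg_with_eigenvalues (local_graph G x) a1 b_plus b_minus)) \<and>
    (tight G \<longleftrightarrow>
      (\<exists>x \<in> verts G. connected_srg_with_eigenvalues (local_graph G x) a1 b_plus b_minus))"
proof -
  let ?D = "graph_dist G" and ?d = "diameter G"
  interpret graph G using assms(1) by (simp add: distance_regular_def)
  interpret connected_graph G using assms(1) by unfold_locales (simp add: distance_regular_def)
  interpret M: distance_regular_metric "verts G" ?D ?d "intersection_number G"
    by (rule distance_regular_metric_of_graph[OF assms(1,2)])
  have int_a: "real (int_a G i) = M.P i i" if "i \<le> ?d" for i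
    using M.p_swap[of i 1 i] that assms(2) by (simp add: int_a_def M.P_def)
  have a1: "a1 = M.a" using int_a[of 1] assms(2,4) by simp
  have b1: "b1 = M.b"
    using M.p_swap[of 1 1 2] assms(2,5) by (simp add: int_b_def M.P_def numeral_2_eq_2)
  have val: "real (valency G) = M.k"
    using assms(2) by (simp add: valency_def int_b_def M.P_def)
  have adj: "adj_op (verts G) (dominates G) f x = adj_op (verts G) (\<lambda>y z. ?D y z = 1) f x"
    if "x \<in> verts G" for f x
    unfolding adj_op_def using that dominates_iff_graph_dist by (intro sum.cong) auto
  have dec: "\<theta> j < \<theta> i" if "i < j" "j \<le> ?d" for i j
    using assms(3) that by (simp add: ordered_eigenvalues_def)
  have "\<exists>\<omega>. M.cosine_sequence (\<theta> j) \<omega>" if "j \<le> ?d" for j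
  proof -
    have "\<theta> j \<in> graph_eigenvalues G" using assms(3) that by (auto simp: ordered_eigenvalues_def)
    then obtain f x where "x \<in> verts G" "f x \<noteq> 0"
      "\<And>y. y \<in> verts G \<Longrightarrow> adj_op (verts G) (\<lambda>y z. ?D y z = 1) f y = \<theta> j * f y"
      unfolding graph_eigenvalues_iff[OF finite_verts] using adj by metis
    then show ?thesis using M.cosine_sequence_exists by metis
  qed
  then obtain \<omega> where \<omega>: "\<And>j. j \<le> ?d \<Longrightarrow> M.cosine_sequence (\<theta> j) (\<omega> j)" by metis
  have card_nbrs: "real (card {z \<in> verts G. ?D y z = 1}) = M.k" if "y \<in> verts G" for y
    using M.card_sphere[OF that, of 1] assms(2) M.sphere_size_1 by simp
  \<comment> \<open>The constants are eigenfunctions for \<open>k\<close>, and no eigenvalue is larger in absolute value.\<close>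
  have \<theta>0: "\<theta> 0 = M.k"
  proof -
    obtain y where y: "y \<in> verts G" using conn by (auto simp: connected_iff)
    have "adj_op (verts G) (dominates G) (\<lambda>_. 1) x = M.k * 1" if "x \<in> verts G" for x
      unfolding adj[OF that] using card_nbrs[OF that] by (simp add: adj_op_def)
    then have "M.k \<in> graph_eigenvalues G"
      unfolding graph_eigenvalues_iff[OF finite_verts] using y
      by (intro exI[of _ "\<lambda>_. 1"]) auto
    then have "M.k \<in> \<theta> ` {0..?d}" using assms(3) by (simp add: ordered_eigenvalues_def)
    then obtain j where "j \<le> ?d" "\<theta> j = M.k" by (metis atLeastAtMost_iff imageE)
    then show ?thesis
      using dec[of 0 j] M.abs_eigenvalue_le[OF \<omega>[of 0]] by (cases "j = 0") auto
  qed
  define u where "u = 1 + \<theta> 1"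
  define v where "v = 1 + \<theta> ?d"
  have u: "0 < u" using M.second_eigenvalue_gt[of \<theta> \<omega>, OF dec \<omega> \<theta>0] by (simp add: u_def)
  have v: "v < 0" using M.least_eigenvalue_less[of \<theta> \<omega>, OF dec \<omega>] by (simp add: v_def)
  have r: "b_minus = - 1 - M.b / u" and s: "b_plus = - 1 - M.b / v"
    using assms(6,7) b1 by (simp_all add: u_def v_def)
  have "0 < M.b / u" "M.b / v < 0" using u v M.b_pos by (simp_all add: divide_pos_neg)
  then have rs: "b_minus < - 1" "- 1 < b_plus" using r s by auto
  let ?eq = "M.k * (M.a + b_minus * b_plus) = (M.a - b_minus) * (M.a - b_plus)"
  let ?T = "\<lambda>\<theta>. (\<theta> 1 + M.k / (M.a + 1)) * (\<theta> ?d + M.k / (M.a + 1))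
    = - (M.k * M.a * M.b) / (M.a + 1)\<^sup>2"
  have T_iff: "?T \<theta> \<longleftrightarrow> ?eq"
    using tight_equation_iff[of M.a u v M.b] M.a_nonneg M.b_pos u v
    unfolding r s M.k_eq u_def v_def by simp
  have tight_iff: "tight G \<longleftrightarrow> \<not> bipartite G \<and> ?eq"
  proof -
    have "?T \<theta>' = ?T \<theta>" if "ordered_eigenvalues G \<theta>'" for \<theta>'
    proof -
      have "\<theta>' 1 = \<theta> 1" "\<theta>' ?d = \<theta> ?d"
        using ordered_eigenvalues_unique[OF that assms(3)] assms(2) by simp_all
      then show ?thesis by (simp only:)
    qed
    then have ex: "(\<exists>\<theta>. ordered_eigenvalues G \<theta> \<and> ?T \<theta>) \<longleftrightarrow> ?T \<theta>" using assms(3) by blast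
    have "tight G \<longleftrightarrow> \<not> bipartite G \<and> (\<exists>\<theta>. ordered_eigenvalues G \<theta> \<and> ?T \<theta>)"
      using a1 b1 unfolding tight_def Let_def val assms(4,5) by (simp only:)
    then show ?thesis unfolding ex T_iff .
  qed
  have loc: "verts (local_graph G x) = {y \<in> verts G. ?D x y = 1}"
    "graph (local_graph G x)"
    "regular_graph_on (verts (local_graph G x)) (dominates (local_graph G x)) M.a"
    "real (card (verts (local_graph G x))) = M.k"
    "verts (local_graph G x) \<noteq> {}"
    "y \<in> verts (local_graph G x) \<Longrightarrow> adj_op (verts (local_graph G x)) (dominates (local_graph G x)) f y
      = adj_op {y \<in> verts G. ?D x y = 1} (\<lambda>y z. ?D y z = 1) f y"
    if x: "x \<in> verts G" for x f y
  proof -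
    show V: "verts (local_graph G x) = {y \<in> verts G. ?D x y = 1}"
      by (simp add: local_graph_def sphere_def)
    show "graph (local_graph G x)"
      unfolding local_graph_def by (rule graph_induce[OF graph_axioms]) (auto simp: sphere_def)
    have dom: "y \<rightarrow>\<^bsub>local_graph G x\<^esub> z \<longleftrightarrow> ?D y z = 1"
      if "y \<in> verts (local_graph G x)" "z \<in> verts (local_graph G x)" for y z
      using that dominates_iff_graph_dist[of y z]
      by (auto simp: local_graph_def dominates_induce_iff sphere_def)
    interpret R: regular_graph_on "{y \<in> verts G. ?D x y = 1}" "\<lambda>y z. ?D y z = 1" M.a
      by (rule M.local_regular[OF x])
    show "regular_graph_on (verts (local_graph G x)) (dominates (local_graph G x)) M.a"
    proof
      fix y assume y: "y \<in> verts (local_graph G x)"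
      have "{z \<in> verts (local_graph G x). y \<rightarrow>\<^bsub>local_graph G x\<^esub> z}
          = {z \<in> {y \<in> verts G. ?D x y = 1}. ?D y z = 1}"
        using dom[OF y] unfolding V by blast
      then show "real (card {z \<in> verts (local_graph G x). y \<rightarrow>\<^bsub>local_graph G x\<^esub> z}) = M.a"
        using R.regular[of y] y unfolding V by simp
    next
      show "finite (verts (local_graph G x))" unfolding V by (rule R.finite_S)
      show "z \<rightarrow>\<^bsub>local_graph G x\<^esub> y" if "y \<in> verts (local_graph G x)"
        "z \<in> verts (local_graph G x)" "y \<rightarrow>\<^bsub>local_graph G x\<^esub> z" for y z
        using that R.sym[of y z] dom unfolding V by blast
      show "\<not> y \<rightarrow>\<^bsub>local_graph G x\<^esub> y" if "y \<in> verts (local_graph G x)" for y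
        using that R.irrefl[of y] dom unfolding V by blast
    qed
    show "real (card (verts (local_graph G x))) = M.k" unfolding V by (rule card_nbrs[OF x])
    then show "verts (local_graph G x) \<noteq> {}" using M.k_pos by auto
    show "adj_op (verts (local_graph G x)) (dominates (local_graph G x)) f y
      = adj_op {y \<in> verts G. ?D x y = 1} (\<lambda>y z. ?D y z = 1) f y"
      if "y \<in> verts (local_graph G x)"
      unfolding adj_op_def using dom[OF that] by (intro sum.cong) (auto simp: V)
  qed
  have local_of_tight: "connected_srg_with_eigenvalues (local_graph G x) a1 b_plus b_minus"
    if tight: "tight G" and x: "x \<in> verts G" for x
  proof -
    let ?H = "local_graph G x"
    interpret R: regular_graph_on "verts ?H" "dominates ?H" M.a by (rule loc(3)[OF x])
    have eq: ?eq using tight tight_iff by blast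
    then have T: "?T \<theta>" using T_iff by simp
    have \<theta>_less: "\<theta> ?d < \<theta> 1" "\<theta> 1 < M.k" "\<theta> ?d < M.k"
      using dec[of 1 ?d] dec[of 0 1] dec[of 0 ?d] assms(2) \<theta>0 by auto
    \<comment> \<open>For \<open>a = 0\<close> the equation is \<open>(\<theta>\<^sub>1 + k) (\<theta>\<^sub>d + k) = 0\<close>, and the first factor is positive.\<close>
    have a_pos: "0 < M.a"
    proof (rule ccontr)
      assume "\<not> 0 < M.a"
      then have "M.a = 0" using M.a_nonneg by simp
      then have "(\<theta> 1 + M.k) * (\<theta> ?d + M.k) = 0" using T by simp
      moreover have "- M.k \<le> \<theta> ?d" using M.abs_eigenvalue_le[OF \<omega>[of ?d]] by simp
      ultimately have "\<theta> ?d = - M.k" using \<theta>_less by simp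
      then have "int_a G i = 0" if "i \<le> ?d" for i
        using M.bipartite_of_minus_valency[of "\<omega> ?d" i] \<omega>[of ?d] int_a[OF that] that by simp
      then have "bipartite G" by (simp add: bipartite_def)
      then show False using tight tight_iff by blast
    qed
    \<comment> \<open>Now the product in the equation is negative, and its smaller factor is the one of \<open>\<theta>\<^sub>d\<close>.\<close>
    have "b_plus < M.a"
    proof -
      have "- (M.k * M.a * M.b) / (M.a + 1)\<^sup>2 < 0"
        using a_pos M.k_pos M.b_pos by (simp add: divide_neg_pos)
      then have "(\<theta> 1 + M.k / (M.a + 1)) * (\<theta> ?d + M.k / (M.a + 1)) < 0" using T by simp
      then have "\<theta> ?d + M.k / (M.a + 1) < 0" using \<theta>_less(1) by (auto simp: mult_less_0_iff)
      then have "(M.a + 1) * v + M.b < 0"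
        using a_pos unfolding v_def M.k_eq by (simp add: field_simps)
      then show ?thesis using v unfolding s by (simp add: field_simps)
    qed
    have lower: "b_minus * (\<Sum>y\<in>verts ?H. f y * f y) \<le> (\<Sum>y\<in>verts ?H. f y * R.A f y)"
      and upper: "(\<Sum>y\<in>verts ?H. f y * R.A f y) \<le> b_plus * (\<Sum>y\<in>verts ?H. f y * f y)"
      if "(\<Sum>y\<in>verts ?H. f y) = 0" for f
    proof -
      define F where "F = (\<Sum>y\<in>verts ?H. f y * f y)"
      define Q where "Q = (\<Sum>y\<in>verts ?H. f y * R.A f y)"
      have Q: "Q = (\<Sum>y\<in>{y \<in> verts G. ?D x y = 1}.
          f y * adj_op {y \<in> verts G. ?D x y = 1} (\<lambda>y z. ?D y z = 1) f y)"
        unfolding Q_def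
      proof (rule sum.cong[OF loc(1)[OF x]])
        fix y assume "y \<in> {y \<in> verts G. ?D x y = 1}"
        then have "y \<in> verts ?H" unfolding loc(1)[OF x] .
        from loc(6)[OF x this, of f] show "f y * R.A f y
            = f y * adj_op {y \<in> verts G. ?D x y = 1} (\<lambda>y z. ?D y z = 1) f y"
          by (simp only:)
      qed
      have form: "0 \<le> (M.b + (1 + \<theta> j)) * F + (1 + \<theta> j) * Q" if "j \<le> ?d" "\<theta> j < M.k" for j
        using M.local_form_bound[OF \<omega>[OF that(1)] that(2) x, of f] \<open>(\<Sum>y\<in>verts ?H. f y) = 0\<close>
        unfolding F_def Q loc(1)[OF x] by (simp add: add.assoc)
      have "0 \<le> (M.b + u) * F + u * Q" "0 \<le> (M.b + v) * F + v * Q"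
        using form[of 1] form[of ?d] \<theta>_less assms(2) by (simp_all add: u_def v_def)
      moreover have "u * b_minus = - (M.b + u)" "v * b_plus = - (M.b + v)"
        using u v unfolding r s by (simp_all add: field_simps)
      then have "u * (Q - b_minus * F) = (M.b + u) * F + u * Q"
        "v * (Q - b_plus * F) = (M.b + v) * F + v * Q"
        by (simp_all only: right_diff_distrib mult.assoc[symmetric] mult_minus_left diff_minus_eq_add add.commute)
      ultimately have "0 \<le> u * (Q - b_minus * F)" "0 \<le> v * (Q - b_plus * F)" by simp_all
      then show "b_minus * F \<le> Q" "Q \<le> b_plus * F"
        using u v by (simp_all add: zero_le_mult_iff)
    qed
    have rs': "b_minus < b_plus" "b_minus \<noteq> - 1" "b_plus \<noteq> - 1" using rs by auto
    have card_eq: "real (card (verts ?H)) * (M.a + b_minus * b_plus) = (M.a - b_minus) * (M.a - b_plus)"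
      using eq loc(4)[OF x] by simp
    show ?thesis
      unfolding a1
      by (rule connected_srg_of_common[OF loc(2,3,5)[OF x] rs'(1) \<open>b_plus < M.a\<close> rs'(2,3) a_pos card_eq
          R.common_eq_of_tight[OF lower upper rs'(1) card_eq]])
  qed
  have tight_of_local: "tight G"
    if x: "x \<in> verts G" and srg: "connected_srg_with_eigenvalues (local_graph G x) a1 b_plus b_minus" for x
  proof -
    note * = connected_srg_imp_tight_equation[OF loc(3,5)[OF x] srg[unfolded a1]]
    have "\<not> bipartite G" using *(2) int_a[of 1] assms(2) unfolding bipartite_def by (auto intro!: exI[of _ 1])
    then show ?thesis using *(1) loc(4)[OF x] tight_iff by simp
  qed
  have "verts G \<noteq> {}" using conn by (auto simp: connected_iff)
  then show ?thesis using local_of_tight tight_of_local by blast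
qed

end
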